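(* Let $X$ be a space. The following statements are equivalent: (1) $X$ is metrizable by a metric $d$ such that $\mathbf{TB}_d(X)=\mathbf{BB}_d(X)$; (2) $X$ is metrizable by a metric $d$ such that $\mu_d=s_f\mu_d$; (3) $X$ is homeomorphic to a subspace of $D^{\omega_0}\times\mathbb R^{\omega_0}$, where $D$ is a discrete space whose cardinality is the cellularity of $X$; (4) $X$ is homeomorphic to a subspace of a countable product of locally compact metric spaces; (5) $X$ is strongly metrizable; (6) $X$ is metrizable by a metric $d$ such that $\mu_d=s_c\mu_d$.
   Context: All spaces are Tychonoff. "Metrizable by a metric $d$" means that $d$ induces the topology of $X$. For a metric space $(X,d)$, the metric uniformity $\mu_d$ is the family of covers of $X$ (uniform covers) refined by $\mathcal B_\varepsilon=\{B_d(x,\varepsilon):x\in X\}$ for some $\varepsilon>0$. For a cover $\mathcal U$ and $A\subset X$: $St(A,\mathcal U)=\bigcup\{U\in\mathcal U: U\cap A\neq\emptyset\}$, $St^0(A,\mathcal U)=A$, $St^m(A,\mathcal U)=St(St^{m-1}(A,\mathcal U),\mathcal U)$; and $B^m_d(x,\varepsilon)=St^{m-1}(B_d(x,\varepsilon),\mathcal B_\varepsilon)$ for $m\ge 1$. $\mathbf{TB}_d(X)$ is the family of totally bounded subsets of $(X,d)$. $\mathbf{BB}_d(X)$ is the family of Bourbaki-bounded subsets in $X$: those $B\subset X$ such that for every $\varepsilon>0$ there are $m\in\mathbb N$ and finitely many $x_1,\dots,x_k\in X$ with $B\subset\bigcup_{i=1}^kB^m_d(x_i,\varepsilon)$. A cover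 is star-finite (star-countable) if each of its members meets at most finitely (countably) many of its members. $\mu_d=s_f\mu_d$ means that the star-finite open covers belonging to $\mu_d$ form a base of $\mu_d$; $\mu_d=s_c\mu_d$ means that the star-countable covers belonging to $\mu_d$ form a base of $\mu_d$. The cellularity of $X$ is here the supremum of the cardinals of all partitions of $X$ by open sets. $X$ is strongly metrizable if it has a base for the topology which is the union of countably many star-finite open covers of $X$. *)

theory Defs
  imports "HOL-Analysis.Analysis"
begin

unbundle cardinal_syntax

text \<open>Covers are sets of subsets of the underlying set, not indexed families.\<close>

definition cover_of :: "'a set \<Rightarrow> 'a set set \<Rightarrow> bool" where
  "cover_of M \<U> \<longleftrightarrow> \<Union>\<U> = M"

definition refines :: "'a set set \<Rightarrow> 'a set set \<Rightarrow> bool" where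
  "refines \<V> \<U> \<longleftrightarrow> (\<forall>V\<in>\<V>. \<exists>U\<in>\<U>. V \<subseteq> U)"

definition star_finite :: "'a set set \<Rightarrow> bool" where
  "star_finite \<U> \<longleftrightarrow> (\<forall>U\<in>\<U>. finite {V\<in>\<U>. V \<inter> U \<noteq> {}})"

definition star_countable :: "'a set set \<Rightarrow> bool" where
  "star_countable \<U> \<longleftrightarrow> (\<forall>U\<in>\<U>. countable {V\<in>\<U>. V \<inter> U \<noteq> {}})"

definition St :: "'a set \<Rightarrow> 'a set set \<Rightarrow> 'a set" where
  "St A \<U> = \<Union>{U\<in>\<U>. U \<inter> A \<noteq> {}}"

fun St_iter :: "nat \<Rightarrow> 'a set \<Rightarrow> 'a set set \<Rightarrow> 'a set" where
  "St_iter 0 A \<U> = A"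
| "St_iter (Suc m) A \<U> = St (St_iter m A \<U>) \<U>"

text \<open>A family of covers \<open>\<B>\<close> is a base of the uniformity \<open>\<mu>\<close> (given by its uniform covers).\<close>

definition uniformity_base :: "'a set set set \<Rightarrow> 'a set set set \<Rightarrow> bool" where
  "uniformity_base \<B> \<mu> \<longleftrightarrow> \<B> \<subseteq> \<mu> \<and> (\<forall>\<U>\<in>\<mu>. \<exists>\<V>\<in>\<B>. refines \<V> \<U>)"

context Metric_space
begin

definition ball_cover :: "real \<Rightarrow> 'a set set" where
  "ball_cover \<epsilon> = (\<lambda>x. mball x \<epsilon>) ` M"

definition metric_uniformity :: "'a set set set" where
  "metric_uniformity = {\<U>. cover_of M \<U> \<and> (\<exists>\<epsilon>>0. refines (ball_cover \<epsilon>) \<U>)}"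

text \<open>The enlarged ball \<open>B\<^sup>m(x,\<epsilon>)\<close>; only meaningful for \<open>m \<ge> 1\<close>.\<close>

definition mball_chain :: "nat \<Rightarrow> 'a \<Rightarrow> real \<Rightarrow> 'a set" where
  "mball_chain m x \<epsilon> = St_iter (m - 1) (mball x \<epsilon>) (ball_cover \<epsilon>)"

definition bourbaki_bounded :: "'a set \<Rightarrow> bool" where
  "bourbaki_bounded B \<longleftrightarrow> B \<subseteq> M \<and>
     (\<forall>\<epsilon>>0. \<exists>m\<ge>1. \<exists>F. finite F \<and> F \<subseteq> M \<and> B \<subseteq> (\<Union>x\<in>F. mball_chain m x \<epsilon>))"

definition TB :: "'a set set" where
  "TB = {B. mtotally_bounded B}"

definition BB :: "'a set set" where
  "BB = {B. bourbaki_bounded B}"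

definition star_finite_base :: bool where
  "star_finite_base \<longleftrightarrow>
     uniformity_base
       {\<U>\<in>metric_uniformity. star_finite \<U> \<and> (\<forall>U\<in>\<U>. openin mtopology U)}
       metric_uniformity"

definition star_countable_base :: bool where
  "star_countable_base \<longleftrightarrow>
     uniformity_base {\<U>\<in>metric_uniformity. star_countable \<U>} metric_uniformity"

end

definition metrized_by :: "'a topology \<Rightarrow> ('a \<Rightarrow> 'a \<Rightarrow> real) \<Rightarrow> bool" where
  "metrized_by X d \<longleftrightarrow>
     Metric_space (topspace X) d \<and> Metric_space.mtopology (topspace X) d = X"

definition strongly_metrizable :: "'a topology \<Rightarrow> bool" where
  "strongly_metrizable X \<longleftrightarrow>
     (\<exists>\<W>::nat \<Rightarrow> 'a set set.
        (\<forall>n. cover_of (topspace X) (\<W> n) \<and> (\<forall>W\<in>\<W> n. openin X W) \<and> star_finite (\<W> n)) \<and>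
        openin X = arbitrary union_of (\<lambda>W. W \<in> (\<Union>n. \<W> n)))"

definition embeds_in :: "'a topology \<Rightarrow> 'b topology \<Rightarrow> bool" where
  "embeds_in X Y \<longleftrightarrow> (\<exists>S\<subseteq>topspace Y. X homeomorphic_space subtopology Y S)"

definition open_partition :: "'a topology \<Rightarrow> 'a set set \<Rightarrow> bool" where
  "open_partition X \<P> \<longleftrightarrow> partition_on (topspace X) \<P> \<and> (\<forall>P\<in>\<P>. openin X P)"

text \<open>
  The cardinal \<open>\<kappa>\<close> is the least upper bound of the cardinals of the open partitions. Every
  such partition is at most as large as the space, so competing upper bounds \<open>\<nu>\<close> need only
  be taken among cardinals on the type \<open>'a\<close>.
\<close>

definition is_cellularity :: "'a topology \<Rightarrow> 'a rel \<Rightarrow> bool" where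
  "is_cellularity X \<kappa> \<longleftrightarrow>
     Card_order \<kappa> \<and> (\<forall>\<P>. open_partition X \<P> \<longrightarrow> |\<P>| \<le>o \<kappa>) \<and>
     (\<forall>\<nu>::'a rel. Card_order \<nu> \<and> (\<forall>\<P>. open_partition X \<P> \<longrightarrow> |\<P>| \<le>o \<nu>) \<longrightarrow> \<kappa> \<le>o \<nu>)"

lemma ex_is_cellularity: "\<exists>D\<subseteq>topspace X. is_cellularity X |D|"
proof -
  define ub where "ub r \<longleftrightarrow> Card_order r \<and> (\<forall>\<P>. open_partition X \<P> \<longrightarrow> |\<P>| \<le>o r)"
    for r :: "'a rel"
  have le: "|\<P>| \<le>o |topspace X|" if "open_partition X \<P>" for \<P>
  proof -
    have p: "partition_on (topspace X) \<P>"
      using that by (simp add: open_partition_def)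
    define f where "f P = (SOME x. x \<in> P)" for P :: "'a set"
    have f: "f P \<in> P" if "P \<in> \<P>" for P
      using partition_onD3[OF p] that unfolding f_def by (metis ex_in_conv someI_ex)
    have "inj_on f \<P>"
    proof (rule inj_onI)
      fix P Q assume *: "P \<in> \<P>" "Q \<in> \<P>" "f P = f Q"
      then have "P \<inter> Q \<noteq> {}"
        using f[of P] f[of Q] by auto
      then show "P = Q"
        using disjointD[OF partition_onD2[OF p] *(1,2)] by blast
    qed
    moreover have "f ` \<P> \<subseteq> topspace X"
      unfolding partition_onD1[OF p] using f by auto
    ultimately show ?thesis
      unfolding card_of_ordLeq[symmetric] by (intro exI conjI)
  qed
  have top: "ub |topspace X|"
    unfolding ub_def using le card_of_Card_order[of "topspace X"] by simp
  have "\<exists>r\<in>Collect ub. \<forall>r'\<in>Collect ub. r \<le>o r'"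
    by (rule exists_minim_Card_order) (use top in \<open>auto simp: ub_def\<close>)
  then obtain r where r: "ub r" and least: "\<And>r'. ub r' \<Longrightarrow> r \<le>o r'"
    by auto
  have fr: "|Field r| =o r"
    by (rule card_of_Field_ordIso) (use r in \<open>simp add: ub_def\<close>)
  have "|Field r| \<le>o |topspace X|"
    by (rule ordIso_ordLeq_trans[OF fr least[OF top]])
  then obtain f where f: "inj_on f (Field r)" "f ` Field r \<subseteq> topspace X"
    unfolding card_of_ordLeq[symmetric] by blast
  have "|Field r| =o |f ` Field r|"
    by (rule card_of_ordIsoI[OF inj_on_imp_bij_betw[OF f(1)]])
  then have Dr: "r =o |f ` Field r|"
    by (rule ordIso_transitive[OF ordIso_symmetric[OF fr]])
  have "is_cellularity X |f ` Field r|"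
    unfolding is_cellularity_def
  proof (intro conjI allI impI)
    show "Card_order |f ` Field r|"
      by (rule card_of_Card_order)
    show "|\<P>| \<le>o |f ` Field r|" if "open_partition X \<P>" for \<P>
      by (rule ordLeq_ordIso_trans[OF _ Dr]) (use r that in \<open>simp add: ub_def\<close>)
    show "|f ` Field r| \<le>o \<nu>"
      if "Card_order \<nu> \<and> (\<forall>\<P>. open_partition X \<P> \<longrightarrow> |\<P>| \<le>o \<nu>)" for \<nu> :: "'a rel"
      by (rule ordIso_ordLeq_trans[OF ordIso_symmetric[OF Dr] least]) (use that in \<open>simp add: ub_def\<close>)
  qed
  with f(2) show ?thesis
    by blast
qed

definition Baire_times_reals :: "'d set \<Rightarrow> ((nat \<Rightarrow> 'd) \<times> (nat \<Rightarrow> real)) topology" where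
  "Baire_times_reals D =
     prod_topology (product_topology (\<lambda>_. discrete_topology D) UNIV)
                   (product_topology (\<lambda>_. euclideanreal) UNIV)"

text \<open>
  The factors have to live on some type, which is passed as an explicit argument, because one
  cannot quantify existentially over types. Countable index sets, finite ones included, are
  represented by subsets of \<open>nat\<close>.
\<close>

definition embeds_in_lc_metric_product :: "'b itself \<Rightarrow> 'a topology \<Rightarrow> bool" where
  "embeds_in_lc_metric_product _ X \<longleftrightarrow>
     (\<exists>(I::nat set) (M::nat \<Rightarrow> 'b set) d.
        (\<forall>i\<in>I. Metric_space (M i) (d i) \<and>
                locally_compact_space (Metric_space.mtopology (M i) (d i))) \<and>
        embeds_in X (product_topology (\<lambda>i. Metric_space.mtopology (M i) (d i)) I))"

definition all_equivalent :: "bool list \<Rightarrow> bool" where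
  "all_equivalent ps \<longleftrightarrow> (\<forall>p\<in>set ps. \<forall>q\<in>set ps. p \<longleftrightarrow> q)"

end

theory Submission
  imports Defs
begin

text \<open>
  All six conditions are shown to be equivalent to the existence of a countable coordinate system
  that induces the topology and consists of locally constant maps and continuous real functions
  (\<open>has_coordinates\<close>).

  Given such coordinates, the supremum of the coordinate distances, the \<open>i\<close>-th one truncated at
  \<open>(1/2) ^ i\<close>, is a metric in which every ball is controlled by finitely many coordinates. Fixing
  finitely many labels and confining finitely many real coordinates to overlapping intervals gives
  star-finite open uniform covers of arbitrarily small mesh (\<open>coordinates_imp_star_finite_base\<close>).
  Such a base makes Bourbaki-bounded sets totally bounded, because iterated stars in a star-finite
  cover are finite unions of members; it also contains a strongly metrizable base. Moreover the
  pieces on which a label is constant form an open partition, so the labels can be taken in a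
  discrete space of the size of the cellularity, and the coordinates embed \<open>X\<close> into
  \<open>D\<^sup>\<omega> \<times> \<real>\<^sup>\<omega>\<close>, which is a countable power of the locally compact space \<open>D \<times> \<real>\<close>.

  Conversely, coordinates arise from a base that is countable on each piece of countably many open
  partitions: by complete regularity, countably many functions on each piece separate points from
  closed sets, and they can be pasted together over the pieces
  (\<open>labelled_base_imp_has_coordinates\<close>). The partitions are obtained from chains.
  \<^item> In a star-countable cover only countably many members can be reached from a given one by
    chains of intersecting members; this handles star-countable bases of the uniformity and
    strongly metrizable spaces.
  \<^item> A locally compact metric space splits into separable clopen pieces, by chains whose steps are
    short compared with the radii of separable balls
    (\<open>locally_separable_imp_separable_partition\<close>).
  \<^item> If totally bounded and Bourbaki-bounded sets coincide, the labels are the \<open>1 / (i + 1)\<close>-chain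
    components. The sets of points within boundedly many steps from a base point form a countable
    family on each component. They need not be small, but around each point the intersection of
    sufficiently many of them, over different \<open>i\<close>, is covered by finitely many balls of any prescribed
    radius (\<open>chain_intersection_finite_cover\<close>), and cutting along these balls gives the base.
\<close>

section \<open>Coordinates: locally constant maps and real functions\<close>

text \<open>Continuity with respect to the discrete topology on the values.\<close>

definition locally_constant :: "'a topology \<Rightarrow> ('a \<Rightarrow> 'l) \<Rightarrow> bool" where
  "locally_constant X c \<longleftrightarrow> (\<forall>x\<in>topspace X. openin X {y\<in>topspace X. c y = c x})"

text \<open>A countable system of coordinates on \<open>X\<close>, half of them locally constant with arbitrary values
  and half of them real, that together induce the topology: the basic neighbourhoods
  of a point are obtained by fixing finitely many coordinates, up to \<open>\<epsilon>\<close> for the real ones.\<close>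

definition coordinates :: "'a topology \<Rightarrow> (nat \<Rightarrow> 'a \<Rightarrow> 'l) \<Rightarrow> (nat \<Rightarrow> 'a \<Rightarrow> real) \<Rightarrow> bool" where
  "coordinates X \<phi> \<psi> \<longleftrightarrow>
     (\<forall>i. locally_constant X (\<phi> i)) \<and> (\<forall>i. continuous_map X euclideanreal (\<psi> i)) \<and>
     (\<forall>U x. openin X U \<and> x \<in> U \<longrightarrow>
        (\<exists>n. \<exists>\<epsilon>>0. {y\<in>topspace X. \<forall>i<n. \<phi> i y = \<phi> i x \<and> \<bar>\<psi> i y - \<psi> i x\<bar> < \<epsilon>} \<subseteq> U))"

text \<open>A value of a locally constant map may always be replaced by the set on which it is attained,
  so sets of points serve as labels; this keeps the notion free of extra type variables.\<close>

definition has_coordinates :: "'a topology \<Rightarrow> bool" where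
  "has_coordinates X \<longleftrightarrow> (\<exists>(\<phi> :: nat \<Rightarrow> 'a \<Rightarrow> 'a set) \<psi>. coordinates X \<phi> \<psi>)"

lemma coordinates_imp_has_coordinates:
  assumes "coordinates X \<phi> \<psi>"
  shows "has_coordinates X"
proof -
  define \<phi>' where "\<phi>' i x = {y\<in>topspace X. \<phi> i y = \<phi> i x}" for i x
  have eq: "\<phi>' i y = \<phi>' i x \<longleftrightarrow> \<phi> i y = \<phi> i x"
    if "x \<in> topspace X" "y \<in> topspace X" for i x y
    using that unfolding \<phi>'_def by (auto simp: set_eq_iff)
  have "coordinates X \<phi>' \<psi>"
    unfolding coordinates_def
  proof (intro conjI allI impI)
    show "locally_constant X (\<phi>' i)" for i
    proof -
      have "{y\<in>topspace X. \<phi>' i y = \<phi>' i x} = {y\<in>topspace X. \<phi> i y = \<phi> i x}"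
        if "x \<in> topspace X" for x
        using that eq by auto
      then show ?thesis
        using assms by (simp add: coordinates_def locally_constant_def)
    qed
    show "continuous_map X euclideanreal (\<psi> i)" for i
      using assms by (simp add: coordinates_def)
    fix U x assume U: "openin X U \<and> x \<in> U"
    then have x: "x \<in> topspace X"
      using openin_subset by blast
    obtain n \<epsilon> where "\<epsilon> > 0"
      and n: "{y\<in>topspace X. \<forall>i<n. \<phi> i y = \<phi> i x \<and> \<bar>\<psi> i y - \<psi> i x\<bar> < \<epsilon>} \<subseteq> U"
      using assms U unfolding coordinates_def by blast
    have "{y\<in>topspace X. \<forall>i<n. \<phi>' i y = \<phi>' i x \<and> \<bar>\<psi> i y - \<psi> i x\<bar> < \<epsilon>} \<subseteq> U"
      using n eq[OF x] by auto
    then show "\<exists>n. \<exists>\<epsilon>>0. {y\<in>topspace X. \<forall>i<n. \<phi>' i y = \<phi>' i x \<and> \<bar>\<psi> i y - \<psi> i x\<bar> < \<epsilon>} \<subseteq> U"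
      using \<open>\<epsilon> > 0\<close> by blast
  qed
  then show ?thesis
    unfolding has_coordinates_def by blast
qed

lemma coordinatesD:
  assumes "coordinates X \<phi> \<psi>" "openin X U" "x \<in> U"
  obtains n \<epsilon> where "\<epsilon> > 0"
    "{y\<in>topspace X. \<forall>i<n. \<phi> i y = \<phi> i x \<and> \<bar>\<psi> i y - \<psi> i x\<bar> < \<epsilon>} \<subseteq> U"
proof -
  have "\<exists>n. \<exists>\<epsilon>>0. {y\<in>topspace X. \<forall>i<n. \<phi> i y = \<phi> i x \<and> \<bar>\<psi> i y - \<psi> i x\<bar> < \<epsilon>} \<subseteq> U"
    using assms by (simp add: coordinates_def)
  then show thesis
    using that by (elim exE conjE)
qed

lemma openin_coordinate_box:
  assumes "coordinates X \<phi> \<psi>" and "x \<in> topspace X"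
  shows "openin X {y\<in>topspace X. \<forall>i<n. \<phi> i y = \<phi> i x \<and> \<bar>\<psi> i y - a i\<bar> < \<epsilon>}"
proof (induction n)
  case (Suc n)
  have a: "openin X {y\<in>topspace X. \<phi> n y = \<phi> n x}"
    using assms by (simp add: coordinates_def locally_constant_def)
  have b: "openin X {y\<in>topspace X. \<psi> n y \<in> ball (a n) \<epsilon>}"
    using assms by (intro openin_continuous_map_preimage[where Y = euclideanreal])
      (auto simp: coordinates_def)
  have "openin X ({y\<in>topspace X. \<forall>i<n. \<phi> i y = \<phi> i x \<and> \<bar>\<psi> i y - a i\<bar> < \<epsilon>} \<inter>
      ({y\<in>topspace X. \<phi> n y = \<phi> n x} \<inter> {y\<in>topspace X. \<psi> n y \<in> ball (a n) \<epsilon>}))"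
    by (rule openin_Int[OF Suc openin_Int[OF a b]])
  moreover have "{y\<in>topspace X. \<forall>i<n. \<phi> i y = \<phi> i x \<and> \<bar>\<psi> i y - a i\<bar> < \<epsilon>} \<inter>
      ({y\<in>topspace X. \<phi> n y = \<phi> n x} \<inter> {y\<in>topspace X. \<psi> n y \<in> ball (a n) \<epsilon>})
    = {y\<in>topspace X. \<forall>i<Suc n. \<phi> i y = \<phi> i x \<and> \<bar>\<psi> i y - a i\<bar> < \<epsilon>}"
    by (auto simp: less_Suc_eq dist_real_def abs_minus_commute)
  ultimately show ?case
    by simp
qed simp

section \<open>Bases that are countable on each piece of open partitions\<close>

text \<open>The \<open>k\<close>-th locally constant map \<open>c k\<close> cuts \<open>X\<close> into clopen pieces, and \<open>\<B> k l\<close> is a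
  countable family of open sets attached to the piece with label \<open>l\<close>. Finite intersections of
  the traces of these sets on their pieces have to form a base of \<open>X\<close>.\<close>

definition labelled_subbase ::
    "'a topology \<Rightarrow> (nat \<Rightarrow> 'a \<Rightarrow> 'l) \<Rightarrow> (nat \<Rightarrow> 'l \<Rightarrow> 'a set set) \<Rightarrow> bool" where
  "labelled_subbase X c \<B> \<longleftrightarrow>
     (\<forall>k. locally_constant X (c k)) \<and>
     (\<forall>k. \<forall>x\<in>topspace X. countable (\<B> k (c k x)) \<and> (\<forall>B\<in>\<B> k (c k x). openin X B)) \<and>
     (\<forall>U x. openin X U \<and> x \<in> U \<longrightarrow>
        (\<exists>K B. finite K \<and> (\<forall>k\<in>K. B k \<in> \<B> k (c k x) \<and> x \<in> B k) \<and>
               {y\<in>topspace X. \<forall>k\<in>K. y \<in> B k \<and> c k y = c k x} \<subseteq> U))"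

text \<open>Here the traces themselves have to form a base.\<close>

definition labelled_base ::
    "'a topology \<Rightarrow> (nat \<Rightarrow> 'a \<Rightarrow> 'l) \<Rightarrow> (nat \<Rightarrow> 'l \<Rightarrow> 'a set set) \<Rightarrow> bool" where
  "labelled_base X c \<B> \<longleftrightarrow>
     (\<forall>k. locally_constant X (c k)) \<and>
     (\<forall>k. \<forall>x\<in>topspace X. countable (\<B> k (c k x)) \<and> (\<forall>B\<in>\<B> k (c k x). openin X B)) \<and>
     (\<forall>U x. openin X U \<and> x \<in> U \<longrightarrow>
        (\<exists>k. \<exists>B\<in>\<B> k (c k x). x \<in> B \<and> {y\<in>B. c k y = c k x} \<subseteq> U))"

lemma labelled_baseI:
  assumes "\<And>k x. x \<in> topspace X \<Longrightarrow> openin X {y\<in>topspace X. c k y = c k x}"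
    and "\<And>k x. x \<in> topspace X \<Longrightarrow> countable (\<B> k (c k x))"
    and "\<And>k x B. \<lbrakk>x \<in> topspace X; B \<in> \<B> k (c k x)\<rbrakk> \<Longrightarrow> openin X B"
    and "\<And>U x. \<lbrakk>openin X U; x \<in> U; x \<in> topspace X\<rbrakk> \<Longrightarrow>
           \<exists>k. \<exists>B\<in>\<B> k (c k x). x \<in> B \<and> {y\<in>B. c k y = c k x} \<subseteq> U"
  shows "labelled_base X c \<B>"
  unfolding labelled_base_def locally_constant_def
proof (intro conjI allI impI ballI)
  show "\<exists>k. \<exists>B\<in>\<B> k (c k x). x \<in> B \<and> {y\<in>B. c k y = c k x} \<subseteq> U" if "openin X U \<and> x \<in> U" for U x
    using assms(4) that openin_subset[of X U] by blast
qed (fact assms)+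

text \<open>The first \<open>n\<close> labels are combined into a list; the whole space is added to each family, so that
  intersections over subsets of \<open>{..<n}\<close> are included.\<close>

lemma labelled_subbase_imp_base:
  fixes c :: "nat \<Rightarrow> 'a \<Rightarrow> 'l"
  assumes sub: "labelled_subbase X c \<B>"
  obtains c' :: "nat \<Rightarrow> 'a \<Rightarrow> 'l list" and \<B>' where "labelled_base X c' \<B>'"
proof
  have lc: "openin X {y\<in>topspace X. c k y = c k x}" if "x \<in> topspace X" for k x
    using sub that by (simp add: labelled_subbase_def locally_constant_def)
  define c' where "c' n x = map (\<lambda>k. c k x) [0..<n]" for n x
  define \<B>' where "\<B>' n ls =
      (\<lambda>B. topspace X \<inter> (\<Inter>k<n. B k)) ` (\<Pi>\<^sub>E k\<in>{..<n}. insert (topspace X) (\<B> k (ls ! k)))" for n ls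
  have c'_eq: "c' n y = c' n x \<longleftrightarrow> (\<forall>k<n. c k y = c k x)" for n x y
    by (auto simp: c'_def)
  have \<B>'_eq: "\<B>' n (c' n x) =
      (\<lambda>B. topspace X \<inter> (\<Inter>k<n. B k)) ` (\<Pi>\<^sub>E k\<in>{..<n}. insert (topspace X) (\<B> k (c k x)))" for n x
    unfolding \<B>'_def by (rule arg_cong[where f = "image _"], rule PiE_cong) (simp add: c'_def)
  show "labelled_base X c' \<B>'"
  proof (rule labelled_baseI)
    show "openin X {y\<in>topspace X. c' k y = c' k x}" if x: "x \<in> topspace X" for k x
    proof -
      have "openin X {y\<in>topspace X. \<forall>i<k. c i y = c i x}"
      proof (induction k)
        case (Suc k)
        have "{y\<in>topspace X. \<forall>i<Suc k. c i y = c i x} =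
            {y\<in>topspace X. \<forall>i<k. c i y = c i x} \<inter> {y\<in>topspace X. c k y = c k x}"
          by (auto simp: less_Suc_eq)
        then show ?case
          using Suc lc[OF x] by (simp add: openin_Int)
      qed simp
      then show ?thesis
        by (simp add: c'_eq)
    qed
    show "countable (\<B>' k (c' k x))" if "x \<in> topspace X" for k x
      unfolding \<B>'_eq
      using sub that by (intro countable_image countable_PiE) (auto simp: labelled_subbase_def)
    show "openin X B" if x: "x \<in> topspace X" and B: "B \<in> \<B>' k (c' k x)" for k x B
    proof -
      obtain b where b: "b \<in> (\<Pi>\<^sub>E i\<in>{..<k}. insert (topspace X) (\<B> i (c i x)))"
        and B: "B = topspace X \<inter> (\<Inter>i<k. b i)"
        using B unfolding \<B>'_eq by blast
      have b_open: "openin X (b i)" if "i < k" for i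
      proof -
        have "b i \<in> insert (topspace X) (\<B> i (c i x))"
          using b that by (auto simp: PiE_iff)
        then show ?thesis
          using sub x unfolding labelled_subbase_def by auto
      qed
      then have "openin X (topspace X \<inter> (\<Inter>i\<in>{..<j}. b i))" if "j \<le> k" for j
        using that
      proof (induction j)
        case (Suc j)
        then have "openin X (topspace X \<inter> (\<Inter>i\<in>{..<j}. b i))" "openin X (b j)"
          using b_open by simp_all
        then have "openin X ((topspace X \<inter> (\<Inter>i\<in>{..<j}. b i)) \<inter> b j)"
          by (rule openin_Int)
        then show ?case
          by (simp only: lessThan_Suc INF_insert Int_ac)
      qed simp
      then show ?thesis
        unfolding B by simp
    qed
    show "\<exists>k. \<exists>B\<in>\<B>' k (c' k x). x \<in> B \<and> {y\<in>B. c' k y = c' k x} \<subseteq> U"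
      if U: "openin X U" "x \<in> U" "x \<in> topspace X" for U x
    proof -
      have "\<exists>K B. finite K \<and> (\<forall>k\<in>K. B k \<in> \<B> k (c k x) \<and> x \<in> B k) \<and>
          {y\<in>topspace X. \<forall>k\<in>K. y \<in> B k \<and> c k y = c k x} \<subseteq> U"
        using sub U(1,2) by (simp add: labelled_subbase_def)
      then obtain K B where K: "finite K" "\<forall>k\<in>K. B k \<in> \<B> k (c k x) \<and> x \<in> B k"
        and sub_U: "{y\<in>topspace X. \<forall>k\<in>K. y \<in> B k \<and> c k y = c k x} \<subseteq> U"
        by (elim exE conjE)
      obtain n where n: "K \<subseteq> {..<n}"
        using finite_nat_iff_bounded[of K] K(1) by blast
      define b where "b = (\<lambda>k\<in>{..<n}. if k \<in> K then B k else topspace X)"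
      have "b \<in> (\<Pi>\<^sub>E k\<in>{..<n}. insert (topspace X) (\<B> k (c k x)))"
        using K by (auto simp: b_def)
      then have "topspace X \<inter> (\<Inter>k<n. b k) \<in> \<B>' n (c' n x)"
        unfolding \<B>'_eq by (rule imageI)
      moreover have "x \<in> topspace X \<inter> (\<Inter>k<n. b k)"
        using K U by (auto simp: b_def)
      moreover have "{y \<in> topspace X \<inter> (\<Inter>k<n. b k). c' n y = c' n x} \<subseteq> U"
      proof
        fix y assume "y \<in> {y \<in> topspace X \<inter> (\<Inter>k<n. b k). c' n y = c' n x}"
        then have y: "y \<in> topspace X" "\<And>k. k < n \<Longrightarrow> y \<in> b k" "\<And>k. k < n \<Longrightarrow> c k y = c k x"
          by (auto simp: c'_eq)
        have "y \<in> B k \<and> c k y = c k x" if "k \<in> K" for k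
          using y(2,3)[of k] that n by (auto simp: b_def)
        then show "y \<in> U"
          using sub_U y(1) by blast
      qed
      ultimately show ?thesis
        by blast
    qed
  qed
qed

text \<open>On each pair of pieces there are only countably many pairs \<open>(W, V)\<close> of basic sets such that
  some continuous function is at least \<open>1\<close> on \<open>W\<close> and at most \<open>0\<close> off \<open>V\<close>. Numbering these pairs on
  all pieces simultaneously yields countably many functions on the whole of \<open>X\<close>; they are
  continuous because the labels are locally constant.\<close>

lemma labelled_base_imp_has_coordinates:
  assumes reg: "completely_regular_space X" and base: "labelled_base X c \<B>"
  shows "has_coordinates X"
proof -
  have lc: "openin X {y\<in>topspace X. c k y = c k x}" if "x \<in> topspace X" for k x
    using base that by (simp add: labelled_base_def locally_constant_def)
  define V where "V k i x = {y\<in>topspace X. c k y = c k x} \<inter> from_nat_into (\<B> k (c k x)) i" for k i x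
  define separates where "separates W' W f \<longleftrightarrow>
      continuous_map X euclideanreal f \<and> (\<forall>y\<in>W'. f y \<ge> 1) \<and> (\<forall>y\<in>topspace X - W. f y \<le> 0)"
    for W' W and f :: "'a \<Rightarrow> real"
  define s where "s W' W = (if \<exists>f. separates W' W f then SOME f. separates W' W f else (\<lambda>_. 0))" for W' W
  have s: "separates W' W (s W' W)" if "separates W' W f" for W' W f
    unfolding s_def using someI[of "separates W' W", OF that] that by auto
  have s_cont: "continuous_map X euclideanreal (s W' W)" for W' W
  proof (cases "\<exists>f. separates W' W f")
    case True
    then show ?thesis
      using s unfolding separates_def by blast
  qed (simp add: s_def)
  define \<psi> where "\<psi> = (\<lambda>N x. case prod_decode N of (p, q) \<Rightarrow>
      case prod_decode p of (k, i) \<Rightarrow> case prod_decode q of (k', j) \<Rightarrow> s (V k' j x) (V k i x) x)"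
  have \<psi>_encode: "\<psi> (prod_encode (prod_encode (k, i), prod_encode (k', j))) x = s (V k' j x) (V k i x) x"
    for k i k' j x
    by (simp add: \<psi>_def)
  have \<psi>_cont: "continuous_map X euclideanreal (\<psi> N)" for N
  proof -
    obtain k i k' j where N: "N = prod_encode (prod_encode (k, i), prod_encode (k', j))"
      by (metis prod_decode_inverse surj_pair)
    define T where "T z = {y\<in>topspace X. c k y = c k z} \<inter> {y\<in>topspace X. c k' y = c k' z}" for z
    have V_eq: "V k i y = V k i z" "V k' j y = V k' j z" if "y \<in> T z" for y z
      using that by (auto simp: V_def T_def)
    show ?thesis
    proof (rule pasting_lemma[where I = "topspace X" and T = T and f = "\<lambda>z. s (V k' j z) (V k i z)"])
      show "openin X (T z)" if "z \<in> topspace X" for z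
        unfolding T_def using lc[OF that] by (simp add: openin_Int)
      show "continuous_map (subtopology X (T z)) euclideanreal (s (V k' j z) (V k i z))" for z
        by (intro continuous_map_from_subtopology s_cont)
      show "s (V k' j y) (V k i y) x = s (V k' j z) (V k i z) x"
        if "x \<in> topspace X \<inter> T y \<inter> T z" for x y z
        using that V_eq[of x y] V_eq[of x z] by auto
      show "\<exists>z. z \<in> topspace X \<and> x \<in> T z \<and> \<psi> N x = s (V k' j z) (V k i z) x"
        if "x \<in> topspace X" for x
        using that unfolding N \<psi>_encode by (intro exI[of _ x]) (auto simp: T_def)
    qed
  qed
  have small: "\<exists>k i. x \<in> V k i x \<and> V k i x \<subseteq> U" if U: "openin X U" "x \<in> U" for U x
  proof -
    have x: "x \<in> topspace X"
      using U openin_subset by blast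
    obtain k B where B: "B \<in> \<B> k (c k x)" "x \<in> B" "{y\<in>B. c k y = c k x} \<subseteq> U"
      using base U unfolding labelled_base_def by blast
    moreover have "countable (\<B> k (c k x))"
      using base x by (simp add: labelled_base_def)
    ultimately obtain i where "from_nat_into (\<B> k (c k x)) i = B"
      using from_nat_into_surj by metis
    then show ?thesis
      using B x by (intro exI[of _ k] exI[of _ i]) (auto simp: V_def)
  qed
  have V_open: "openin X (V k i x)" if "x \<in> V k i x" "\<B> k (c k x) \<noteq> {}" for k i x
  proof -
    have x: "x \<in> topspace X"
      using that by (auto simp: V_def)
    have "from_nat_into (\<B> k (c k x)) i \<in> \<B> k (c k x)"
      by (rule from_nat_into[OF that(2)])
    then have "openin X (from_nat_into (\<B> k (c k x)) i)"
      using base x by (simp add: labelled_base_def)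
    then show ?thesis
      unfolding V_def using lc[OF x] by (simp add: openin_Int)
  qed
  have "coordinates X c \<psi>"
    unfolding coordinates_def
  proof (intro conjI allI impI)
    show "locally_constant X (c i)" for i
      using base by (simp add: labelled_base_def)
    show "continuous_map X euclideanreal (\<psi> i)" for i
      by (rule \<psi>_cont)
    fix U x assume "openin X U \<and> x \<in> U"
    then have U: "openin X U" "x \<in> U"
      by auto
    then have x: "x \<in> topspace X"
      using openin_subset by blast
    obtain k B where B: "B \<in> \<B> k (c k x)" "x \<in> B" "{y\<in>B. c k y = c k x} \<subseteq> U"
      using base U unfolding labelled_base_def by blast
    moreover have "countable (\<B> k (c k x))"
      using base x by (simp add: labelled_base_def)
    ultimately obtain i where i: "from_nat_into (\<B> k (c k x)) i = B"
      using from_nat_into_surj by metis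
    then have V: "x \<in> V k i x" "V k i x \<subseteq> U"
      using B x by (auto simp: V_def)
    have "openin X (V k i x)"
      using V_open[OF V(1)] B by auto
    then have "closedin X (topspace X - V k i x)"
      by blast
    then obtain f :: "'a \<Rightarrow> real" where f: "continuous_map X (top_of_set {0..1}) f" "f x = 0"
      "f ` (topspace X - V k i x) \<subseteq> {1}"
      using reg V(1) x unfolding completely_regular_space_def by blast
    have f_cont: "continuous_map X euclideanreal f"
      using f(1) by (simp add: continuous_map_in_subtopology)
    have "openin X {y\<in>topspace X. f y \<in> {..<1/2}}"
      by (rule openin_continuous_map_preimage[OF f_cont]) simp
    then obtain k' j where V': "x \<in> V k' j x" "V k' j x \<subseteq> {y\<in>topspace X. f y \<in> {..<1/2}}"
      using small[of "{y\<in>topspace X. f y \<in> {..<1/2}}" x] x f(2) by auto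
    have "separates (V k' j x) (V k i x) (\<lambda>y. 2 - 2 * f y)"
      unfolding separates_def
    proof (intro conjI ballI)
      show "continuous_map X euclideanreal (\<lambda>y. 2 - 2 * f y)"
        by (intro continuous_intros f_cont)
      show "1 \<le> 2 - 2 * f y" if "y \<in> V k' j x" for y
        using that V'(2) by force
      show "2 - 2 * f y \<le> 0" if "y \<in> topspace X - V k i x" for y
        using that f(3) by auto
    qed
    then have sep: "separates (V k' j x) (V k i x) (s (V k' j x) (V k i x))"
      by (rule s)
    define N where "N = prod_encode (prod_encode (k, i), prod_encode (k', j))"
    define n where "n = Suc (max N (max k k'))"
    have "y \<in> U" if y: "y \<in> topspace X" "\<And>m. m < n \<Longrightarrow> c m y = c m x \<and> \<bar>\<psi> m y - \<psi> m x\<bar> < 1" for y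
    proof -
      have "c k y = c k x" "c k' y = c k' x" "\<bar>\<psi> N y - \<psi> N x\<bar> < 1"
        using y(2)[of k] y(2)[of k'] y(2)[of N] by (auto simp: n_def)
      moreover from this have "V k i y = V k i x" "V k' j y = V k' j x"
        by (auto simp: V_def)
      moreover have "1 \<le> \<psi> N x"
        using sep V'(1) by (simp add: N_def \<psi>_encode separates_def)
      ultimately have "s (V k' j x) (V k i x) y > 0"
        by (simp add: N_def \<psi>_encode)
      then have "y \<in> V k i x"
        using sep y(1) unfolding separates_def by force
      then show ?thesis
        using V(2) by blast
    qed
    then have "{y\<in>topspace X. \<forall>m<n. c m y = c m x \<and> \<bar>\<psi> m y - \<psi> m x\<bar> < 1} \<subseteq> U"
      by blast
    then show "\<exists>n. \<exists>\<epsilon>>0. {y\<in>topspace X. \<forall>m<n. c m y = c m x \<and> \<bar>\<psi> m y - \<psi> m x\<bar> < \<epsilon>} \<subseteq> U"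
      using zero_less_one by blast
  qed
  then show ?thesis
    by (rule coordinates_imp_has_coordinates)
qed

section \<open>A metric whose uniformity has a base of star-finite open covers\<close>

text \<open>The metric is the supremum over \<open>i\<close> of the distances in the \<open>i\<close>-th coordinates, the discrete
  distance being used on labels, truncated at \<open>(1/2) ^ i\<close>. A ball of radius \<open>\<epsilon>\<close> is thus controlled
  by finitely many coordinates, and the real line has star-finite covers by intervals.\<close>

lemma coordinates_imp_star_finite_base:
  fixes \<phi> :: "nat \<Rightarrow> 'a \<Rightarrow> 'l"
  assumes haus: "Hausdorff_space X" and coords: "coordinates X \<phi> \<psi>"
  shows "\<exists>d. metrized_by X d \<and> Metric_space.star_finite_base (topspace X) d"
proof -
  define e where "e i x y = (if \<phi> i x = \<phi> i y then 0 else 1) + \<bar>\<psi> i x - \<psi> i y\<bar>" for i x y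
  define d where "d x y = (SUP i. min ((1/2) ^ i) (e i x y))" for x y
  have e_nonneg: "0 \<le> e i x y" for i x y
    by (simp add: e_def)
  have e_commute: "e i x y = e i y x" for i x y
    by (simp add: e_def abs_minus_commute)
  have e_triangle: "e i x z \<le> e i x y + e i y z" for i x y z
    unfolding e_def by auto
  have e_less: "e i x y < r \<longleftrightarrow> \<phi> i x = \<phi> i y \<and> \<bar>\<psi> i x - \<psi> i y\<bar> < r" if "r \<le> 1" for i x y r
    using that by (auto simp: e_def)
  have bdd: "bdd_above (range (\<lambda>i. min ((1/2) ^ i) (e i x y)))" for x y
    by (rule bdd_aboveI[of _ 1]) (auto simp: min_le_iff_disj power_le_one)
  have le_d: "min ((1/2) ^ i) (e i x y) \<le> d x y" for i x y
    unfolding d_def by (rule cSUP_upper[OF _ bdd]) simp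
  have d_le: "d x y \<le> r" if "\<And>i. min ((1/2) ^ i) (e i x y) \<le> r" for x y r
    unfolding d_def by (rule cSUP_least) (use that in auto)
  have d_le': "d x y \<le> r" if "\<And>i. i < n \<Longrightarrow> e i x y \<le> r" and "(1/2) ^ n \<le> r" for x y r n
  proof (rule d_le)
    fix i
    show "min ((1/2) ^ i) (e i x y) \<le> r"
    proof (cases "i < n")
      case False
      then have "(1/2::real) ^ i \<le> (1/2) ^ n"
        by (intro power_decreasing) auto
      then show ?thesis
        using that(2) by linarith
    qed (use that in \<open>simp add: min_le_iff_disj\<close>)
  qed
  have e_of_d: "e i x y < r" if "d x y < r" "r \<le> (1/2) ^ n" "i \<le> n" for i x y r n
  proof -
    have "(1/2::real) ^ n \<le> (1/2) ^ i"
      using that by (intro power_decreasing) auto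
    then show ?thesis
      using le_d[of i x y] that by linarith
  qed
  have small_power: "\<exists>n. (1/2) ^ n < r" if "0 < r" for r :: real
    using real_arch_pow_inv[OF that, of "1/2"] by simp
  interpret Metric_space "topspace X" d
  proof
    show "0 \<le> d x y" for x y
      using le_d[of 0 x y] e_nonneg[of 0 x y] by auto
    show "d x y = d y x" for x y
      unfolding d_def by (simp add: e_commute)
    show "d x z \<le> d x y + d y z" for x y z
    proof (rule d_le)
      fix i
      have "min ((1/2) ^ i) (e i x z) \<le> min ((1/2) ^ i) (e i x y) + min ((1/2) ^ i) (e i y z)"
        using e_triangle[of i x z y] e_nonneg[of i x y] e_nonneg[of i y z]
          zero_le_power[of "1/2::real" i] by linarith
      then show "min ((1/2) ^ i) (e i x z) \<le> d x y + d y z"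
        using le_d[of i x y] le_d[of i y z] by linarith
    qed
    show "d x y = 0 \<longleftrightarrow> x = y" if xy: "x \<in> topspace X" "y \<in> topspace X" for x y
    proof
      assume "x = y"
      have "d x x \<le> 0"
        by (rule d_le) (simp add: e_def)
      then show "d x y = 0"
        using \<open>x = y\<close> le_d[of 0 x y] e_nonneg[of 0 x y] by auto
    next
      assume 0: "d x y = 0"
      have e0: "e i x y = 0" for i
        using le_d[of i x y] e_nonneg[of i x y] 0 zero_less_power[of "1/2::real" i] by linarith
      show "x = y"
      proof (rule ccontr)
        assume "x \<noteq> y"
        then obtain U where U: "openin X U" "x \<in> U" "y \<notin> U"
          using Hausdorff_imp_t1_space[OF haus] xy by (meson t1_space_def)
        obtain n \<epsilon> where "\<epsilon> > 0"
          and "{y\<in>topspace X. \<forall>i<n. \<phi> i y = \<phi> i x \<and> \<bar>\<psi> i y - \<psi> i x\<bar> < \<epsilon>} \<subseteq> U"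
          by (rule coordinatesD[OF coords U(1,2)])
        moreover have "\<phi> i y = \<phi> i x \<and> \<bar>\<psi> i y - \<psi> i x\<bar> < \<epsilon>" for i
          using e0[of i] \<open>\<epsilon> > 0\<close> unfolding e_def by (auto split: if_splits)
        ultimately show False
          using xy(2) U(3) by blast
      qed
    qed
  qed
  have mtop: "mtopology = X"
    unfolding topology_eq
  proof (intro allI iffI)
    fix U assume U: "openin X U"
    show "openin mtopology U"
      unfolding openin_mtopology
    proof (intro conjI allI impI)
      show "U \<subseteq> topspace X"
        using U by (rule openin_subset)
      fix x assume x: "x \<in> U"
      obtain n \<epsilon> where "\<epsilon> > 0"
        and n: "{y\<in>topspace X. \<forall>i<n. \<phi> i y = \<phi> i x \<and> \<bar>\<psi> i y - \<psi> i x\<bar> < \<epsilon>} \<subseteq> U"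
        by (rule coordinatesD[OF coords U x])
      define r where "r = min \<epsilon> ((1/2) ^ n)"
      have r: "0 < r" "r \<le> \<epsilon>" "r \<le> (1/2) ^ n" "r \<le> 1"
        using \<open>\<epsilon> > 0\<close> by (auto simp: r_def min_le_iff_disj power_le_one)
      have "mball x r \<subseteq> {y\<in>topspace X. \<forall>i<n. \<phi> i y = \<phi> i x \<and> \<bar>\<psi> i y - \<psi> i x\<bar> < \<epsilon>}"
      proof
        fix y assume "y \<in> mball x r"
        then have y: "y \<in> topspace X" "d x y < r"
          by auto
        have "\<phi> i y = \<phi> i x \<and> \<bar>\<psi> i y - \<psi> i x\<bar> < \<epsilon>" if "i < n" for i
          using e_of_d[OF y(2) r(3), of i] that r(2) e_less[OF r(4), of i x y] by auto
        then show "y \<in> {y\<in>topspace X. \<forall>i<n. \<phi> i y = \<phi> i x \<and> \<bar>\<psi> i y - \<psi> i x\<bar> < \<epsilon>}"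
          using y(1) by blast
      qed
      then show "\<exists>r>0. mball x r \<subseteq> U"
        using r(1) n by blast
    qed
  next
    fix U assume U: "openin mtopology U"
    show "openin X U"
    proof (subst openin_subopen, intro ballI)
      fix x assume "x \<in> U"
      then obtain r where "0 < r" and r: "mball x r \<subseteq> U" and x: "x \<in> topspace X"
        using U unfolding openin_mtopology by blast
      obtain n where n: "(1/2) ^ n < r/2"
        using small_power[of "r/2"] \<open>0 < r\<close> by auto
      define T where "T = {y\<in>topspace X. \<forall>i<n. \<phi> i y = \<phi> i x \<and> \<bar>\<psi> i y - \<psi> i x\<bar> < r/2}"
      have "openin X T"
        unfolding T_def by (rule openin_coordinate_box[OF coords x])
      moreover have "x \<in> T"
        using x \<open>0 < r\<close> by (simp add: T_def)
      moreover have "T \<subseteq> mball x r"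
      proof
        fix y assume y: "y \<in> T"
        have "d x y \<le> r/2"
        proof (rule d_le'[of n])
          show "e i x y \<le> r/2" if "i < n" for i
            using y that by (auto simp: T_def e_def abs_minus_commute)
        qed (use n in simp)
        then show "y \<in> mball x r"
          using x y \<open>0 < r\<close> by (simp add: T_def)
      qed
      ultimately show "\<exists>T. openin X T \<and> x \<in> T \<and> T \<subseteq> U"
        using r by blast
    qed
  qed
  have "star_finite_base"
    unfolding star_finite_base_def uniformity_base_def
  proof (intro conjI ballI)
    show "{\<U>\<in>metric_uniformity. star_finite \<U> \<and> (\<forall>U\<in>\<U>. openin mtopology U)} \<subseteq> metric_uniformity"
      by blast
    fix \<U> assume "\<U> \<in> metric_uniformity"
    then obtain \<epsilon> where "0 < \<epsilon>" and \<epsilon>: "refines (ball_cover \<epsilon>) \<U>"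
      by (auto simp: metric_uniformity_def)
    obtain n where n: "(1/2) ^ n < \<epsilon>/2"
      using small_power[of "\<epsilon>/2"] \<open>0 < \<epsilon>\<close> by auto
    define \<delta> where "\<delta> = \<epsilon>/4"
    have "0 < \<delta>"
      using \<open>0 < \<epsilon>\<close> by (simp add: \<delta>_def)
    define cell where "cell x k =
        {y\<in>topspace X. \<forall>i<n. \<phi> i y = \<phi> i x \<and> \<bar>\<psi> i y - of_int (k i) * \<delta>\<bar> < \<delta>}" for x and k :: "nat \<Rightarrow> int"
    define \<V> where "\<V> = {cell x k |x k. x \<in> cell x k}"
    have near: "\<bar>r - of_int (round (r/\<delta>)) * \<delta>\<bar> \<le> \<delta>/2" for r
    proof -
      have "\<bar>of_int (round (r/\<delta>)) - r/\<delta>\<bar> * \<delta> \<le> (1/2) * \<delta>"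
        using of_int_round_abs_le[of "r/\<delta>"] \<open>0 < \<delta>\<close> by (intro mult_right_mono) auto
      moreover have "\<bar>of_int (round (r/\<delta>)) - r/\<delta>\<bar> * \<delta> = \<bar>(of_int (round (r/\<delta>)) - r/\<delta>) * \<delta>\<bar>"
        using \<open>0 < \<delta>\<close> by (simp add: abs_mult)
      moreover have "(of_int (round (r/\<delta>)) - r/\<delta>) * \<delta> = of_int (round (r/\<delta>)) * \<delta> - r"
        using \<open>0 < \<delta>\<close> by (simp add: algebra_simps)
      ultimately show ?thesis
        by (simp add: abs_minus_commute)
    qed
    \<comment> \<open>\<open>centre x\<close> are the indices of the intervals in whose middle halves the coordinates of \<open>x\<close> lie.\<close>
    define centre where "centre x i = round (\<psi> i x / \<delta>)" for x i
    have in_cell: "x \<in> cell x (centre x)" if "x \<in> topspace X" for x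
      using that near \<open>0 < \<delta>\<close> unfolding cell_def centre_def
      by (auto intro!: le_less_trans[OF near])
    have uniform: "refines (ball_cover (min (\<delta>/2) ((1/2) ^ n))) \<V>"
      unfolding refines_def ball_cover_def
    proof clarify
      fix x assume x: "x \<in> topspace X"
      define r where "r = min (min (\<delta>/2) ((1/2) ^ n)) 1"
      have r: "r \<le> \<delta>/2" "r \<le> (1/2) ^ n" "r \<le> 1" "r = min (\<delta>/2) ((1/2) ^ n)"
        using power_le_one[of "1/2::real" n] by (auto simp: r_def)
      have "mball x r \<subseteq> cell x (centre x)"
      proof
        fix y assume "y \<in> mball x r"
        then have y: "y \<in> topspace X" "d x y < r"
          by auto
        have "\<phi> i y = \<phi> i x \<and> \<bar>\<psi> i y - of_int (centre x i) * \<delta>\<bar> < \<delta>" if "i < n" for i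
        proof -
          have "\<phi> i x = \<phi> i y \<and> \<bar>\<psi> i x - \<psi> i y\<bar> < r"
            using e_of_d[OF y(2) r(2), of i] that e_less[OF r(3), of i x y] by auto
          moreover have "\<bar>\<psi> i x - of_int (centre x i) * \<delta>\<bar> \<le> \<delta>/2"
            unfolding centre_def by (rule near)
          ultimately have "\<bar>\<psi> i y - of_int (centre x i) * \<delta>\<bar> < \<delta>"
            using r(1) by linarith
          then show ?thesis
            using \<open>\<phi> i x = \<phi> i y \<and> \<bar>\<psi> i x - \<psi> i y\<bar> < r\<close> by simp
        qed
        then show "y \<in> cell x (centre x)"
          using y(1) by (simp add: cell_def)
      qed
      then show "\<exists>U\<in>\<V>. mball x (min (\<delta>/2) ((1/2) ^ n)) \<subseteq> U"
        using in_cell[OF x] r(4) unfolding \<V>_def by auto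
    qed
    have cover: "cover_of (topspace X) \<V>"
    proof -
      have "cell x k \<subseteq> topspace X" for x k
        by (auto simp: cell_def)
      then show ?thesis
        unfolding cover_of_def \<V>_def using in_cell by blast
    qed
    have finer: "refines \<V> (ball_cover \<epsilon>)"
      unfolding refines_def
    proof
      fix V assume "V \<in> \<V>"
      then obtain x k where V: "V = cell x k" and x: "x \<in> cell x k"
        by (auto simp: \<V>_def)
      have "V \<subseteq> mball x \<epsilon>"
      proof
        fix y assume y: "y \<in> V"
        have "d x y \<le> \<epsilon>/2"
        proof (rule d_le'[of n])
          fix i assume "i < n"
          then have "\<phi> i y = \<phi> i x" "\<bar>\<psi> i y - of_int (k i) * \<delta>\<bar> < \<delta>" "\<bar>\<psi> i x - of_int (k i) * \<delta>\<bar> < \<delta>"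
            using x y by (auto simp: V cell_def)
          then have "\<phi> i y = \<phi> i x" "\<bar>\<psi> i x - \<psi> i y\<bar> \<le> 2 * \<delta>"
            by linarith+
          then show "e i x y \<le> \<epsilon>/2"
            by (simp add: e_def \<delta>_def)
        qed (use n in simp)
        then show "y \<in> mball x \<epsilon>"
          using x y \<open>0 < \<epsilon>\<close> by (simp add: V cell_def)
      qed
      then show "\<exists>U\<in>ball_cover \<epsilon>. V \<subseteq> U"
        using x by (auto simp: ball_cover_def cell_def)
    qed
    have "star_finite \<V>"
      unfolding star_finite_def
    proof
      fix V assume "V \<in> \<V>"
      then obtain x k where V: "V = cell x k"
        by (auto simp: \<V>_def)
      have "{W\<in>\<V>. W \<inter> V \<noteq> {}} \<subseteq> cell x ` (\<Pi>\<^sub>E i\<in>{..<n}. {k i - 1..k i + 1})"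
      proof
        fix W assume "W \<in> {W\<in>\<V>. W \<inter> V \<noteq> {}}"
        then obtain y where "W \<in> \<V>" and y: "y \<in> W" "y \<in> V"
          by blast
        then obtain x' k' where W: "W = cell x' k'"
          by (auto simp: \<V>_def)
        have "k' i \<in> {k i - 1..k i + 1}" if "i < n" for i
        proof -
          have "\<bar>of_int (k' i) * \<delta> - of_int (k i) * \<delta>\<bar> < 2 * \<delta>"
            using y that unfolding V W cell_def by force
          then have "\<bar>(of_int (k' i) - of_int (k i)) * \<delta>\<bar> < 2 * \<delta>"
            by (simp add: left_diff_distrib)
          then have "\<bar>of_int (k' i) - of_int (k i)\<bar> < (2::real)"
            using \<open>0 < \<delta>\<close> by (simp add: abs_mult)
          then show ?thesis
            by auto
        qed
        then have "restrict k' {..<n} \<in> (\<Pi>\<^sub>E i\<in>{..<n}. {k i - 1..k i + 1})"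
          by auto
        moreover have "W = cell x (restrict k' {..<n})"
        proof -
          have "\<phi> i x' = \<phi> i x" if "i < n" for i
            using y that unfolding V W cell_def by auto
          then show ?thesis
            unfolding W cell_def by auto
        qed
        ultimately show "W \<in> cell x ` (\<Pi>\<^sub>E i\<in>{..<n}. {k i - 1..k i + 1})"
          by blast
      qed
      then show "finite {W\<in>\<V>. W \<inter> V \<noteq> {}}"
        by (rule finite_subset) (intro finite_imageI finite_PiE; simp)
    qed
    moreover have "openin mtopology V" if V_in: "V \<in> \<V>" for V
    proof -
      obtain x k where V: "V = cell x k" and "x \<in> topspace X"
        using V_in by (auto simp: \<V>_def cell_def)
      then show ?thesis
        unfolding mtop V cell_def by (intro openin_coordinate_box[OF coords])
    qed
    moreover have "\<V> \<in> metric_uniformity"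
      using cover uniform \<open>0 < \<delta>\<close> unfolding metric_uniformity_def
      by (auto intro!: exI[of _ "min (\<delta>/2) ((1/2) ^ n)"])
    moreover have "refines \<V> \<U>"
      using finer \<epsilon> unfolding refines_def by (meson order_trans)
    ultimately show "\<exists>\<V>\<in>{\<U>\<in>metric_uniformity. star_finite \<U> \<and> (\<forall>U\<in>\<U>. openin mtopology U)}.
        refines \<V> \<U>"
      by blast
  qed
  moreover have "metrized_by X d"
    unfolding metrized_by_def using mtop Metric_space_axioms by simp
  ultimately show ?thesis
    by blast
qed

section \<open>Embeddings into products\<close>

lemma embeds_in_iff_embedding_map: "embeds_in X Y \<longleftrightarrow> (\<exists>f. embedding_map X Y f)"
proof
  assume "embeds_in X Y"
  then obtain S f where "homeomorphic_map X (subtopology Y S) f"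
    unfolding embeds_in_def homeomorphic_space by blast
  then have "embedding_map X (subtopology Y S) f"
    using surjective_embedding_map by blast
  then show "\<exists>f. embedding_map X Y f"
    using embedding_map_in_subtopology by blast
next
  assume "\<exists>f. embedding_map X Y f"
  then obtain f where f: "embedding_map X Y f"
    by blast
  have "f ` topspace X \<subseteq> topspace Y"
    using homeomorphic_imp_surjective_map[OF f[unfolded embedding_map_def]]
    unfolding topspace_subtopology by blast
  then show "embeds_in X Y"
    unfolding embeds_in_def using embedding_map_imp_homeomorphic_space[OF f] by blast
qed

lemma embeds_in_homeomorphic_space:
  assumes "embeds_in X Y" and "Y homeomorphic_space Z"
  shows "embeds_in X Z"
proof -
  obtain f where f: "embedding_map X Y f"
    using assms(1) embeds_in_iff_embedding_map by blast
  obtain g where "homeomorphic_map Y Z g"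
    using assms(2)[unfolded homeomorphic_space] by (elim exE)
  then have "embedding_map Y Z g"
    using surjective_embedding_map by blast
  then show ?thesis
    using embedding_map_compose[OF f] embeds_in_iff_embedding_map by blast
qed

lemma embedding_mapI:
  assumes cont: "continuous_map X Y f" and "t0_space X"
    and nbhd: "\<And>U x. \<lbrakk>openin X U; x \<in> U\<rbrakk> \<Longrightarrow>
      \<exists>T. openin Y T \<and> f x \<in> T \<and> {y\<in>topspace X. f y \<in> T} \<subseteq> U"
  shows "embedding_map X Y f"
proof -
  have "inj_on f (topspace X)"
  proof (rule inj_onI, rule ccontr)
    fix x y assume xy: "x \<in> topspace X" "y \<in> topspace X" "f x = f y" "x \<noteq> y"
    then obtain U where U: "openin X U" "x \<in> U \<longleftrightarrow> y \<notin> U"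
      using \<open>t0_space X\<close> unfolding t0_space_def by metis
    have eq: "z \<in> U" if z: "w \<in> U" "f w = f z" "z \<in> topspace X" for w z
    proof -
      obtain T where "f w \<in> T" "{y\<in>topspace X. f y \<in> T} \<subseteq> U"
        using nbhd[OF U(1) z(1)] by blast
      then show ?thesis
        using z by auto
    qed
    show False
      using eq[of x y] eq[of y x] U(2) xy by auto
  qed
  moreover have "continuous_map X (subtopology Y (f ` topspace X)) f"
    using cont by (simp add: continuous_map_in_subtopology)
  moreover have "open_map X (subtopology Y (f ` topspace X)) f"
    unfolding open_map_def
  proof (intro allI impI)
    fix U assume U: "openin X U"
    define \<T> where "\<T> = {T. openin Y T \<and> {y\<in>topspace X. f y \<in> T} \<subseteq> U}"
    have "f ` U = \<Union>\<T> \<inter> f ` topspace X"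
    proof
      show "f ` U \<subseteq> \<Union>\<T> \<inter> f ` topspace X"
      proof
        fix z assume "z \<in> f ` U"
        then obtain x where x: "x \<in> U" "z = f x"
          by blast
        obtain T where "openin Y T" "f x \<in> T" "{y\<in>topspace X. f y \<in> T} \<subseteq> U"
          using nbhd[OF U x(1)] by blast
        then show "z \<in> \<Union>\<T> \<inter> f ` topspace X"
          using x openin_subset[OF U] unfolding \<T>_def by blast
      qed
      show "\<Union>\<T> \<inter> f ` topspace X \<subseteq> f ` U"
        by (auto simp: \<T>_def)
    qed
    moreover have "openin Y (\<Union>\<T>)"
      by (rule openin_Union) (simp add: \<T>_def)
    ultimately show "openin (subtopology Y (f ` topspace X)) (f ` U)"
      unfolding openin_subtopology by blast
  qed
  ultimately have "embedding_map X (subtopology Y (f ` topspace X)) f"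
    by (intro injective_open_imp_embedding_map)
  then show ?thesis
    using embedding_map_in_subtopology by blast
qed

text \<open>The pieces on which one of the labels is constant form an open partition, so there are no more
  of them than the cellularity.\<close>

lemma coordinates_imp_embeds_in_Baire_times_reals:
  fixes X :: "'a topology" and D :: "'a set"
  assumes haus: "Hausdorff_space X" and coords: "coordinates X \<phi> \<psi>"
    and cell: "is_cellularity X |D|"
  shows "embeds_in X (Baire_times_reals D)"
proof -
  define piece where "piece i x = {y\<in>topspace X. \<phi> i y = \<phi> i x}" for i x
  have piece_eq: "piece i x = piece i y \<longleftrightarrow> \<phi> i x = \<phi> i y"
    if "x \<in> topspace X" "y \<in> topspace X" for i x y
    using that by (auto simp: piece_def set_eq_iff)
  have "open_partition X (piece i ` topspace X)" for i
    unfolding open_partition_def partition_on_def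
  proof (intro conjI ballI)
    show "\<Union>(piece i ` topspace X) = topspace X"
      by (auto simp: piece_def)
    show "disjoint (piece i ` topspace X)"
      by (rule disjointI) (auto simp: piece_def)
    show "{} \<notin> piece i ` topspace X"
      by (auto simp: piece_def)
    show "openin X P" if "P \<in> piece i ` topspace X" for P
      using coords that by (auto simp: coordinates_def locally_constant_def piece_def)
  qed
  then have "\<exists>h. inj_on h (piece i ` topspace X) \<and> h ` (piece i ` topspace X) \<subseteq> D" for i
    using cell unfolding is_cellularity_def card_of_ordLeq by blast
  then obtain h where h: "\<And>i. inj_on (h i) (piece i ` topspace X)"
    "\<And>i. h i ` (piece i ` topspace X) \<subseteq> D"
    by metis
  define a where "a x = (\<lambda>i. h i (piece i x))" for x
  have a_eq: "a y i = a x i \<longleftrightarrow> \<phi> i y = \<phi> i x" if "x \<in> topspace X" "y \<in> topspace X" for i x y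
    using that h(1)[of i] piece_eq[of y x i] by (auto simp: a_def inj_on_def)
  have a_D: "a x i \<in> D" if "x \<in> topspace X" for i x
    using h(2)[of i] that by (auto simp: a_def)
  define f where "f x = (a x, \<lambda>i. \<psi> i x)" for x
  have "embedding_map X (Baire_times_reals D) f"
  proof (rule embedding_mapI)
    show "t0_space X"
      using haus Hausdorff_imp_t1_space t1_imp_t0_space by blast
    show "continuous_map X (Baire_times_reals D) f"
      unfolding Baire_times_reals_def continuous_map_pairwise o_def continuous_map_componentwise_UNIV
    proof (intro conjI allI)
      show "continuous_map X (discrete_topology D) (\<lambda>x. fst (f x) i)" for i
        unfolding continuous_map_def f_def fst_conv
      proof (intro conjI allI impI)
        show "(\<lambda>x. a x i) \<in> topspace X \<rightarrow> topspace (discrete_topology D)"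
          using a_D by simp
        fix S
        show "openin X {x\<in>topspace X. a x i \<in> S}"
        proof (subst openin_subopen, intro ballI)
          fix x assume x: "x \<in> {x\<in>topspace X. a x i \<in> S}"
          have "openin X (piece i x)"
            using coords x by (auto simp: coordinates_def locally_constant_def piece_def)
          moreover have "piece i x \<subseteq> {x\<in>topspace X. a x i \<in> S}"
          proof
            fix y assume "y \<in> piece i x"
            then have "y \<in> topspace X" "a y i = a x i"
              using x a_eq[of x y i] by (auto simp: piece_def)
            then show "y \<in> {x\<in>topspace X. a x i \<in> S}"
              using x by simp
          qed
          ultimately show "\<exists>T. openin X T \<and> x \<in> T \<and> T \<subseteq> {x\<in>topspace X. a x i \<in> S}"
            using x by (intro exI[of _ "piece i x"]) (auto simp: piece_def)
        qed
      qed
      show "continuous_map X euclideanreal (\<lambda>x. snd (f x) i)" for i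
        using coords by (simp add: f_def coordinates_def)
    qed
    fix U x assume U: "openin X U" "x \<in> U"
    then have x: "x \<in> topspace X"
      using openin_subset by blast
    obtain n \<epsilon> where "\<epsilon> > 0"
      and n: "{y\<in>topspace X. \<forall>i<n. \<phi> i y = \<phi> i x \<and> \<bar>\<psi> i y - \<psi> i x\<bar> < \<epsilon>} \<subseteq> U"
      by (rule coordinatesD[OF coords U])
    define A where "A = (\<Pi>\<^sub>E i\<in>UNIV. if i < n then {a x i} else D)"
    define R where "R = (\<Pi>\<^sub>E i\<in>UNIV. if i < n then ball (\<psi> i x) \<epsilon> else UNIV)"
    have "openin (product_topology (\<lambda>_. discrete_topology D) UNIV) A"
      unfolding A_def
      by (rule product_topology_basis) (use a_D[OF x] in \<open>auto intro: finite_subset[OF _ finite_lessThan[of n]]\<close>)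
    moreover have "openin (product_topology (\<lambda>_. euclideanreal) UNIV) R"
      unfolding R_def
      by (rule product_topology_basis) (auto intro: finite_subset[OF _ finite_lessThan[of n]])
    ultimately have "openin (Baire_times_reals D) (A \<times> R)"
      by (simp add: Baire_times_reals_def openin_prod_Times_iff)
    moreover have "f x \<in> A \<times> R"
      using a_D[OF x] \<open>\<epsilon> > 0\<close> by (auto simp: f_def A_def R_def)
    moreover have "{y\<in>topspace X. f y \<in> A \<times> R} \<subseteq> U"
    proof
      fix y assume "y \<in> {y\<in>topspace X. f y \<in> A \<times> R}"
      then have y: "y \<in> topspace X" "f y \<in> A \<times> R"
        by auto
      have "\<phi> i y = \<phi> i x \<and> \<bar>\<psi> i y - \<psi> i x\<bar> < \<epsilon>" if "i < n" for i
      proof -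
        have "a y i \<in> (if i < n then {a x i} else D)"
          "\<psi> i y \<in> (if i < n then ball (\<psi> i x) \<epsilon> else UNIV)"
          using y(2) by (auto simp: f_def A_def R_def PiE_iff)
        then show ?thesis
          using that a_eq[OF x y(1)] by (auto simp: dist_real_def abs_minus_commute)
      qed
      then show "y \<in> U"
        using n y(1) by blast
    qed
    ultimately show "\<exists>T. openin (Baire_times_reals D) T \<and> f x \<in> T \<and> {y\<in>topspace X. f y \<in> T} \<subseteq> U"
      by (intro exI[of _ "A \<times> R"] conjI)
  qed
  then show ?thesis
    using embeds_in_iff_embedding_map by blast
qed

text \<open>Pairing the coordinates turns the product of the two powers into a power of \<open>D \<times> \<real>\<close>.\<close>

lemma Baire_times_reals_homeomorphic_power:
  "Baire_times_reals D homeomorphic_space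
     product_topology (\<lambda>_::nat. prod_topology (discrete_topology D) euclideanreal) UNIV"
proof -
  let ?P = "prod_topology (discrete_topology D) euclideanreal"
  have "homeomorphic_maps (Baire_times_reals D) (product_topology (\<lambda>_::nat. ?P) UNIV)
      (\<lambda>p i. (fst p i, snd p i)) (\<lambda>q. (\<lambda>i. fst (q i), \<lambda>i. snd (q i)))"
    unfolding homeomorphic_maps_def
  proof (intro conjI)
    have "continuous_map (Baire_times_reals D) (discrete_topology D) (\<lambda>p. fst p i)" for i
      unfolding Baire_times_reals_def
      using continuous_map_compose[OF continuous_map_fst continuous_map_product_projection[of i UNIV]]
      by (simp add: o_def)
    moreover have "continuous_map (Baire_times_reals D) euclideanreal (\<lambda>p. snd p i)" for i
      unfolding Baire_times_reals_def
      using continuous_map_compose[OF continuous_map_snd continuous_map_product_projection[of i UNIV]]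
      by (simp add: o_def)
    ultimately show "continuous_map (Baire_times_reals D) (product_topology (\<lambda>_. ?P) UNIV)
        (\<lambda>p i. (fst p i, snd p i))"
      by (simp add: continuous_map_componentwise_UNIV continuous_map_pairwise o_def)
    have "continuous_map (product_topology (\<lambda>_::nat. ?P) UNIV) ?P (\<lambda>q. q i)" for i
      by (rule continuous_map_product_projection) simp
    then show "continuous_map (product_topology (\<lambda>_::nat. ?P) UNIV) (Baire_times_reals D)
        (\<lambda>q. (\<lambda>i. fst (q i), \<lambda>i. snd (q i)))"
      by (simp add: Baire_times_reals_def continuous_map_componentwise_UNIV continuous_map_pairwise o_def)
  qed auto
  then show ?thesis
    by (rule homeomorphic_maps_imp_homeomorphic_space)
qed

lemma embeds_in_Baire_times_reals_imp_lc_metric_product: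
  fixes X :: "'a topology" and D :: "'d set"
  assumes "embeds_in X (Baire_times_reals D)"
  shows "embeds_in_lc_metric_product TYPE('d \<times> real) X"
proof -
  interpret discrete_metric D .
  interpret Metric_space12 D dd "UNIV :: real set" dist
    by (intro Metric_space12.intro disc.Metric_space_axioms Met_TC.Metric_space_axioms)
  have top: "Prod_metric.mtopology = prod_topology (discrete_topology D) euclideanreal"
    by (simp add: mtopology_prod_metric mtopology_discrete_metric)
  have "locally_compact_space Prod_metric.mtopology"
    unfolding top locally_compact_space_prod_topology
    by (simp add: locally_compact_space_discrete_topology locally_compact_space_euclidean)
  moreover have "embeds_in X (product_topology (\<lambda>_::nat. Prod_metric.mtopology) UNIV)"
    unfolding top
    by (rule embeds_in_homeomorphic_space[OF assms Baire_times_reals_homeomorphic_power])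
  ultimately show ?thesis
    unfolding embeds_in_lc_metric_product_def
    using Prod_metric.Metric_space_axioms
    by (intro exI[of _ UNIV] exI[of _ "\<lambda>_. D \<times> UNIV"] exI[of _ "\<lambda>_. prod_dist dd dist"]) simp
qed

section \<open>Locally compact metric spaces\<close>

context Metric_space
begin

text \<open>The countable set that approximates the points of \<open>S\<close> need not lie in \<open>S\<close>; this makes the
  notion pass trivially to subsets.\<close>

definition separable_in :: "'a set \<Rightarrow> bool" where
  "separable_in S \<longleftrightarrow> (\<exists>D. countable D \<and> D \<subseteq> M \<and> (\<forall>y\<in>S. \<forall>e>0. \<exists>z\<in>D. d z y < e))"

lemma separable_in_subset: "\<lbrakk>separable_in T; S \<subseteq> T\<rbrakk> \<Longrightarrow> separable_in S"
  unfolding separable_in_def by (meson subsetD)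

lemma separable_in_UN:
  assumes "countable I" and "\<And>i. i \<in> I \<Longrightarrow> separable_in (S i)"
  shows "separable_in (\<Union>i\<in>I. S i)"
proof -
  have "\<forall>i\<in>I. \<exists>D. countable D \<and> D \<subseteq> M \<and> (\<forall>y\<in>S i. \<forall>e>0. \<exists>z\<in>D. d z y < e)"
    using assms(2) by (simp add: separable_in_def)
  then obtain D where D: "\<And>i. i \<in> I \<Longrightarrow> countable (D i)" "\<And>i. i \<in> I \<Longrightarrow> D i \<subseteq> M"
    "\<And>i y e. \<lbrakk>i \<in> I; y \<in> S i; e > 0\<rbrakk> \<Longrightarrow> \<exists>z\<in>D i. d z y < e"
    by metis
  show ?thesis
    unfolding separable_in_def
  proof (intro exI conjI ballI allI impI)
    show "countable (\<Union>i\<in>I. D i)"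
      using assms(1) D(1) by (rule countable_UN)
    show "(\<Union>i\<in>I. D i) \<subseteq> M"
      using D(2) by blast
    show "\<exists>z\<in>\<Union>i\<in>I. D i. d z y < e" if y: "y \<in> (\<Union>i\<in>I. S i)" and "0 < e" for y e
    proof -
      obtain i where i: "i \<in> I" "y \<in> S i"
        using y by blast
      then show ?thesis
        using D(3)[OF i \<open>0 < e\<close>] by blast
    qed
  qed
qed

lemma mtotally_bounded_imp_separable_in:
  assumes "mtotally_bounded S"
  shows "separable_in S"
proof -
  have "\<forall>n::nat. \<exists>K. finite K \<and> K \<subseteq> S \<and> S \<subseteq> (\<Union>x\<in>K. mball x (1 / Suc n))"
    using assms by (simp add: mtotally_bounded_def)
  then obtain K where K: "\<And>n. finite (K n)" "\<And>n. K n \<subseteq> S" "\<And>n. S \<subseteq> (\<Union>x\<in>K n. mball x (1 / Suc n))"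
    by metis
  show ?thesis
    unfolding separable_in_def
  proof (intro exI conjI ballI allI impI)
    show "countable (\<Union>n. K n)"
      using K(1) by (intro countable_UN) (simp_all add: countable_finite)
    show "(\<Union>n. K n) \<subseteq> M"
      using K(2) mtotally_bounded_imp_subset[OF assms] by blast
    show "\<exists>z\<in>\<Union>n. K n. d z y < e" if y: "y \<in> S" and "0 < e" for y e
    proof -
      obtain n where n: "1 / real (Suc n) < e"
        using \<open>0 < e\<close> by (metis nat_approx_posE)
      obtain z where "z \<in> K n" "d z y < 1 / real (Suc n)"
        using K(3)[of n] y by auto
      then have "d z y < e" "z \<in> (\<Union>n. K n)"
        using n by auto
      then show ?thesis
        by blast
    qed
  qed
qed

text \<open>A locally separable metric space splits into separable clopen pieces. Choose for each \<open>x\<close> the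
  largest radius \<open>\<rho> x = (1/2) ^ n\<close> for which the ball around \<open>x\<close> is separable, and join two points
  whose distance is much smaller than both of their radii. Since \<open>\<rho>\<close> at most doubles or halves
  along a link, countably many balls of radius \<open>\<rho>\<close> suffice to take one more step from a separable
  set, and so all points that can be reached by finite chains form a separable set.\<close>

lemma locally_separable_imp_separable_partition:
  assumes loc: "\<And>x. x \<in> M \<Longrightarrow> \<exists>r>0. separable_in (mball x r)"
  obtains c :: "'a \<Rightarrow> 'a set"
  where "\<And>x. x \<in> M \<Longrightarrow> openin mtopology {y\<in>M. c y = c x}"
    and "\<And>x. x \<in> M \<Longrightarrow> separable_in (c x)"
    and "\<And>x y. \<lbrakk>x \<in> M; y \<in> M; c y = c x\<rbrakk> \<Longrightarrow> y \<in> c x"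
proof
  define \<nu> where "\<nu> x = (LEAST n. separable_in (mball x ((1/2) ^ n)))" for x
  define \<rho> where "\<rho> x = (1/2::real) ^ \<nu> x" for x
  have \<rho>_pos: "0 < \<rho> x" for x
    by (simp add: \<rho>_def)
  have sep: "separable_in (mball x (\<rho> x))" if x: "x \<in> M" for x
  proof -
    obtain r where "r > 0" and r: "separable_in (mball x r)"
      using loc[OF x] by blast
    obtain n where "(1/2) ^ n < r"
      using real_arch_pow_inv[OF \<open>r > 0\<close>, of "1/2"] by auto
    then have "separable_in (mball x ((1/2) ^ n))"
      by (intro separable_in_subset[OF r] mball_subset_concentric) simp
    then show ?thesis
      unfolding \<rho>_def \<nu>_def by (rule LeastI)
  qed
  have \<rho>_half: "\<rho> x / 2 \<le> \<rho> y" if xy: "x \<in> M" "y \<in> M" "d x y < \<rho> x / 2" for x y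
  proof -
    have "mball y (\<rho> x / 2) \<subseteq> mball x (\<rho> x)"
      using xy by (intro mball_subset) (auto simp: commute)
    then have "separable_in (mball y ((1/2) ^ Suc (\<nu> x)))"
      using separable_in_subset[OF sep[OF xy(1)]] by (simp add: \<rho>_def)
    then have "\<nu> y \<le> Suc (\<nu> x)"
      unfolding \<nu>_def[of y] by (rule Least_le)
    then have "(1/2::real) ^ Suc (\<nu> x) \<le> (1/2) ^ \<nu> y"
      by (intro power_decreasing) auto
    then show ?thesis
      by (simp add: \<rho>_def)
  qed
  define R where "R = {(x, y). x \<in> M \<and> y \<in> M \<and> d x y < \<rho> x / 4 \<and> d x y < \<rho> y / 4}"
  define c where "c x = R\<^sup>* `` {x}" for x
  have "sym R"
    by (auto simp: R_def sym_def commute)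
  then have "equiv UNIV (R\<^sup>*)"
    by (intro equivI) (auto simp: refl_rtrancl sym_rtrancl trans_rtrancl)
  then have c_eq: "c y = c x \<longleftrightarrow> (x, y) \<in> R\<^sup>*" for x y
    unfolding c_def using eq_equiv_class_iff[of UNIV "R\<^sup>*" x y] by auto
  show "y \<in> c x" if "x \<in> M" "y \<in> M" "c y = c x" for x y
    using that(3) c_eq by (simp add: c_def)
  show "openin mtopology {y\<in>M. c y = c x}" if "x \<in> M" for x
    unfolding openin_mtopology
  proof (intro conjI allI impI)
    fix y assume "y \<in> {y\<in>M. c y = c x}"
    then have y: "y \<in> M" "c y = c x"
      by auto
    have "mball y (\<rho> y / 8) \<subseteq> {y\<in>M. c y = c x}"
    proof
      fix z assume "z \<in> mball y (\<rho> y / 8)"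
      then have z: "z \<in> M" "d y z < \<rho> y / 8"
        by auto
      moreover have "\<rho> y / 2 \<le> \<rho> z"
        using y(1) z \<rho>_pos[of y] by (intro \<rho>_half) auto
      ultimately have "(y, z) \<in> R"
        using y(1) \<rho>_pos[of y] by (auto simp: R_def)
      then have "c z = c y"
        using c_eq by blast
      then show "z \<in> {y\<in>M. c y = c x}"
        using y(2) z(1) by simp
    qed
    then show "\<exists>r>0. mball y r \<subseteq> {y\<in>M. c y = c x}"
      using \<rho>_pos[of y] by (intro exI[of _ "\<rho> y / 8"]) simp
  qed auto
  show "separable_in (c x)" if x: "x \<in> M" for x
  proof -
    have "separable_in ((R ^^ n) `` {x})" for n
    proof (induction n)
      case 0
      have "mtotally_bounded {x}"
        using x by simp
      then have "separable_in {x}"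
        by (rule mtotally_bounded_imp_separable_in)
      then show ?case
        by simp
    next
      case (Suc n)
      then obtain D where D: "countable D" "D \<subseteq> M"
        "\<And>y e. \<lbrakk>y \<in> (R ^^ n) `` {x}; e > 0\<rbrakk> \<Longrightarrow> \<exists>z\<in>D. d z y < e"
        unfolding separable_in_def by blast
      have "separable_in (\<Union>z\<in>D. mball z (\<rho> z))"
        using D(2) sep by (intro separable_in_UN[OF D(1)]) blast
      moreover have "(R ^^ Suc n) `` {x} \<subseteq> (\<Union>z\<in>D. mball z (\<rho> z))"
      proof
        fix w assume "w \<in> (R ^^ Suc n) `` {x}"
        then obtain y where y: "y \<in> (R ^^ n) `` {x}" "(y, w) \<in> R"
          by auto
        then have w: "y \<in> M" "w \<in> M" "d y w < \<rho> y / 4"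
          by (auto simp: R_def)
        obtain z where z: "z \<in> D" "d z y < \<rho> y / 4"
          using D(3)[OF y(1), of "\<rho> y / 4"] \<rho>_pos[of y] by auto
        then have "z \<in> M"
          using D(2) by blast
        then have "\<rho> y / 2 \<le> \<rho> z"
          using w z \<rho>_pos[of y] by (intro \<rho>_half) (auto simp: commute)
        moreover have "d z w \<le> d z y + d y w"
          using w \<open>z \<in> M\<close> by (intro triangle)
        ultimately have "w \<in> mball z (\<rho> z)"
          using w z \<open>z \<in> M\<close> by simp
        then show "w \<in> (\<Union>z\<in>D. mball z (\<rho> z))"
          using z(1) by blast
      qed
      ultimately show ?case
        by (rule separable_in_subset)
    qed
    then have "separable_in (\<Union>n. (R ^^ n) `` {x})"
      by (intro separable_in_UN) auto
    moreover have "c x = (\<Union>n. (R ^^ n) `` {x})"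
      unfolding c_def rtrancl_is_UN_relpow by blast
    ultimately show ?thesis
      by simp
  qed
qed

lemma locally_compact_imp_piecewise_countable_base:
  assumes "locally_compact_space mtopology"
  shows "\<exists>(c :: 'a \<Rightarrow> 'a set) \<B>.
    (\<forall>x\<in>M. openin mtopology {y\<in>M. c y = c x}) \<and>
    (\<forall>x\<in>M. countable (\<B> (c x)) \<and> (\<forall>B\<in>\<B> (c x). openin mtopology B)) \<and>
    (\<forall>U x. openin mtopology U \<and> x \<in> U \<longrightarrow> (\<exists>B\<in>\<B> (c x). x \<in> B \<and> B \<subseteq> U))"
proof -
  have loc: "\<exists>r>0. separable_in (mball x r)" if x: "x \<in> M" for x
  proof -
    obtain U K where U: "openin mtopology U" "x \<in> U" "U \<subseteq> K" and K: "compactin mtopology K"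
      using assms x unfolding locally_compact_space_def topspace_mtopology by metis
    obtain r where "r > 0" "mball x r \<subseteq> U"
      using U(1,2) unfolding openin_mtopology by blast
    moreover have "separable_in K"
      using K by (intro mtotally_bounded_imp_separable_in compactin_imp_mtotally_bounded)
    ultimately show ?thesis
      using U(3) separable_in_subset by (meson order_trans)
  qed
  obtain c :: "'a \<Rightarrow> 'a set" where c: "\<And>x. x \<in> M \<Longrightarrow> openin mtopology {y\<in>M. c y = c x}"
    "\<And>x. x \<in> M \<Longrightarrow> separable_in (c x)" "\<And>x y. \<lbrakk>x \<in> M; y \<in> M; c y = c x\<rbrakk> \<Longrightarrow> y \<in> c x"
    using locally_separable_imp_separable_partition[OF loc] by metis
  have "\<forall>S. \<exists>D. separable_in S \<longrightarrow> countable D \<and> D \<subseteq> M \<and> (\<forall>y\<in>S. \<forall>e>0. \<exists>z\<in>D. d z y < e)"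
    by (auto simp: separable_in_def)
  then obtain D where D: "\<And>S. separable_in S \<Longrightarrow> countable (D S)" "\<And>S. separable_in S \<Longrightarrow> D S \<subseteq> M"
    "\<And>S y e. \<lbrakk>separable_in S; y \<in> S; e > 0\<rbrakk> \<Longrightarrow> \<exists>z\<in>D S. d z y < e"
    by metis
  define \<B> where "\<B> l = (\<lambda>(z, n). mball z (1 / Suc n)) ` (D l \<times> (UNIV :: nat set))" for l
  show ?thesis
  proof (intro exI[of _ c] exI[of _ \<B>] conjI ballI allI impI)
    show "openin mtopology {y\<in>M. c y = c x}" if "x \<in> M" for x
      using that by (rule c(1))
    show "countable (\<B> (c x))" if "x \<in> M" for x
      unfolding \<B>_def using D(1)[OF c(2)[OF that]] by (intro countable_image countable_SIGMA) auto
    show "openin mtopology B" if "x \<in> M" "B \<in> \<B> (c x)" for x B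
      using that(2) by (auto simp: \<B>_def)
    fix U x assume U: "openin mtopology U \<and> x \<in> U"
    then have x: "x \<in> M"
      using openin_mtopology by blast
    obtain r where "r > 0" and r: "mball x r \<subseteq> U"
      using U unfolding openin_mtopology by blast
    obtain n where n: "1 / real (Suc n) < r/2"
      using \<open>r > 0\<close> by (metis half_gt_zero nat_approx_posE)
    have "x \<in> c x"
      using c(3)[OF x x] by simp
    then obtain z where z: "z \<in> D (c x)" "d z x < 1 / Suc n"
      using D(3)[OF c(2)[OF x], of x "1 / Suc n"] by auto
    then have "z \<in> M"
      using D(2)[OF c(2)[OF x]] by blast
    have "mball z (1 / Suc n) \<subseteq> mball x r"
      using z n x by (intro mball_subset) auto
    moreover have "mball z (1 / Suc n) \<in> \<B> (c x)"
      unfolding \<B>_def using z(1) by (intro image_eqI[of _ _ "(z, n)"]) auto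
    moreover have "x \<in> mball z (1 / Suc n)"
      using z x \<open>z \<in> M\<close> by simp
    ultimately show "\<exists>B\<in>\<B> (c x). x \<in> B \<and> B \<subseteq> U"
      using r by (intro bexI[of _ "mball z (1 / Suc n)"]) auto
  qed
qed

end

text \<open>The pieces of the factors give the labels on \<open>X\<close>, and the preimages of the members of their
  countable bases give the basic sets.\<close>

lemma embeds_in_lc_metric_product_imp_has_coordinates:
  fixes X :: "'a topology"
  assumes reg: "completely_regular_space X" and "embeds_in_lc_metric_product TYPE('b) X"
  shows "has_coordinates X"
proof -
  obtain I :: "nat set" and M :: "nat \<Rightarrow> 'b set" and d
    where lc: "\<forall>i\<in>I. Metric_space (M i) (d i) \<and> locally_compact_space (Metric_space.mtopology (M i) (d i))"
      and emb: "embeds_in X (product_topology (\<lambda>i. Metric_space.mtopology (M i) (d i)) I)"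
    using assms(2) unfolding embeds_in_lc_metric_product_def by (elim exE conjE)
  define Y where "Y i = Metric_space.mtopology (M i) (d i)" for i
  have topY: "topspace (Y i) = M i" if "i \<in> I" for i
    unfolding Y_def by (rule Metric_space.topspace_mtopology) (use lc that in blast)
  obtain f where f: "embedding_map X (product_topology Y I) f"
    using emb unfolding embeds_in_iff_embedding_map Y_def by (elim exE)
  have f_cont: "continuous_map X (product_topology Y I) f"
    using f by (meson embedding_map_def continuous_map_in_subtopology homeomorphic_imp_continuous_map)
  have fi_cont: "continuous_map X (Y i) (\<lambda>x. f x i)" if "i \<in> I" for i
    using f_cont that unfolding continuous_map_componentwise by blast
  have fi: "f x i \<in> M i" if "i \<in> I" "x \<in> topspace X" for i x
    using continuous_map_image_subset_topspace[OF fi_cont[OF that(1)]] topY[OF that(1)] that(2) by blast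
  have "\<forall>i. \<exists>(c :: 'b \<Rightarrow> 'b set) \<B>. i \<in> I \<longrightarrow>
    (\<forall>x\<in>M i. openin (Y i) {y\<in>M i. c y = c x}) \<and>
    (\<forall>x\<in>M i. countable (\<B> (c x)) \<and> (\<forall>B\<in>\<B> (c x). openin (Y i) B)) \<and>
    (\<forall>U x. openin (Y i) U \<and> x \<in> U \<longrightarrow> (\<exists>B\<in>\<B> (c x). x \<in> B \<and> B \<subseteq> U))"
  proof
    fix i
    show "\<exists>(c :: 'b \<Rightarrow> 'b set) \<B>. i \<in> I \<longrightarrow>
      (\<forall>x\<in>M i. openin (Y i) {y\<in>M i. c y = c x}) \<and>
      (\<forall>x\<in>M i. countable (\<B> (c x)) \<and> (\<forall>B\<in>\<B> (c x). openin (Y i) B)) \<and>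
      (\<forall>U x. openin (Y i) U \<and> x \<in> U \<longrightarrow> (\<exists>B\<in>\<B> (c x). x \<in> B \<and> B \<subseteq> U))"
    proof (cases "i \<in> I")
      case True
      then show ?thesis
        using Metric_space.locally_compact_imp_piecewise_countable_base[of "M i" "d i"] lc
        unfolding Y_def by simp
    qed simp
  qed
  from choice[OF this] obtain c :: "nat \<Rightarrow> 'b \<Rightarrow> 'b set" where
    "\<forall>i. \<exists>\<B>. i \<in> I \<longrightarrow>
      (\<forall>x\<in>M i. openin (Y i) {y\<in>M i. c i y = c i x}) \<and>
      (\<forall>x\<in>M i. countable (\<B> (c i x)) \<and> (\<forall>B\<in>\<B> (c i x). openin (Y i) B)) \<and>
      (\<forall>U x. openin (Y i) U \<and> x \<in> U \<longrightarrow> (\<exists>B\<in>\<B> (c i x). x \<in> B \<and> B \<subseteq> U))"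
    by (elim exE)
  from choice[OF this] obtain \<B> where cB: "\<forall>i. i \<in> I \<longrightarrow>
      (\<forall>x\<in>M i. openin (Y i) {y\<in>M i. c i y = c i x}) \<and>
      (\<forall>x\<in>M i. countable (\<B> i (c i x)) \<and> (\<forall>B\<in>\<B> i (c i x). openin (Y i) B)) \<and>
      (\<forall>U x. openin (Y i) U \<and> x \<in> U \<longrightarrow> (\<exists>B\<in>\<B> i (c i x). x \<in> B \<and> B \<subseteq> U))"
    by (elim exE)
  have c: "\<And>i x. \<lbrakk>i \<in> I; x \<in> M i\<rbrakk> \<Longrightarrow> openin (Y i) {y\<in>M i. c i y = c i x}"
    and B: "\<And>i x. \<lbrakk>i \<in> I; x \<in> M i\<rbrakk> \<Longrightarrow> countable (\<B> i (c i x))"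
    "\<And>i x B. \<lbrakk>i \<in> I; x \<in> M i; B \<in> \<B> i (c i x)\<rbrakk> \<Longrightarrow> openin (Y i) B"
    "\<And>i U x. \<lbrakk>i \<in> I; openin (Y i) U; x \<in> U\<rbrakk> \<Longrightarrow> \<exists>B\<in>\<B> i (c i x). x \<in> B \<and> B \<subseteq> U"
    using cB by simp_all
  define c' where "c' i x = (if i \<in> I then c i (f x i) else {})" for i x
  define \<B>' where "\<B>' i l = (if i \<in> I then (\<lambda>B. {x\<in>topspace X. f x i \<in> B}) ` \<B> i l else {})" for i l
  have "labelled_subbase X c' \<B>'"
    unfolding labelled_subbase_def
  proof (intro conjI allI impI ballI)
    show "locally_constant X (c' i)" for i
      unfolding locally_constant_def
    proof
      fix x assume x: "x \<in> topspace X"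
      show "openin X {y\<in>topspace X. c' i y = c' i x}"
      proof (cases "i \<in> I")
        case True
        have "openin X {y\<in>topspace X. f y i \<in> {z\<in>M i. c i z = c i (f x i)}}"
          by (rule openin_continuous_map_preimage[OF fi_cont[OF True] c[OF True fi[OF True x]]])
        moreover have "{y\<in>topspace X. f y i \<in> {z\<in>M i. c i z = c i (f x i)}} =
            {y\<in>topspace X. c' i y = c' i x}"
          using True fi[OF True] by (auto simp: c'_def)
        ultimately show ?thesis
          by simp
      qed (simp add: c'_def)
    qed
    show "countable (\<B>' i (c' i x))" if "x \<in> topspace X" for i x
      using B(1)[of i "f x i"] fi[of i x] that by (simp add: \<B>'_def c'_def)
    show "openin X b" if x: "x \<in> topspace X" and b: "b \<in> \<B>' i (c' i x)" for i x b
    proof -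
      have "i \<in> I"
        using b by (auto simp: \<B>'_def split: if_splits)
      then obtain B where "B \<in> \<B> i (c i (f x i))" "b = {x\<in>topspace X. f x i \<in> B}"
        using b by (auto simp: \<B>'_def c'_def)
      then show ?thesis
        using openin_continuous_map_preimage[OF fi_cont[OF \<open>i \<in> I\<close>]] B(2)[OF \<open>i \<in> I\<close> fi[OF \<open>i \<in> I\<close> x]]
        by simp
    qed
    fix U x assume U: "openin X U \<and> x \<in> U"
    then have x: "x \<in> topspace X"
      using openin_subset by blast
    have hom: "homeomorphic_map X (subtopology (product_topology Y I) (f ` topspace X)) f"
      using f by (simp add: embedding_map_def)
    have inj: "inj_on f (topspace X)"
      using hom by (rule homeomorphic_imp_injective_map)
    have "openin (subtopology (product_topology Y I) (f ` topspace X)) (f ` U)"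
      using hom U by (simp add: homeomorphic_map_openness_eq)
    then obtain T where T: "openin (product_topology Y I) T" "f ` U = T \<inter> f ` topspace X"
      unfolding openin_subtopology by (elim exE conjE)
    then have "f x \<in> T"
      using U by blast
    then have "\<exists>V. finite {i\<in>I. V i \<noteq> topspace (Y i)} \<and> (\<forall>i\<in>I. openin (Y i) (V i)) \<and>
        f x \<in> Pi\<^sub>E I V \<and> Pi\<^sub>E I V \<subseteq> T"
      using T(1) unfolding openin_product_topology_alt by simp
    then obtain V where V: "finite {i\<in>I. V i \<noteq> topspace (Y i)}" "\<forall>i\<in>I. openin (Y i) (V i)"
      "f x \<in> Pi\<^sub>E I V" "Pi\<^sub>E I V \<subseteq> T"
      by (elim exE conjE)
    define K where "K = {i\<in>I. V i \<noteq> topspace (Y i)}"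
    have "\<forall>i\<in>K. \<exists>B\<in>\<B> i (c i (f x i)). f x i \<in> B \<and> B \<subseteq> V i"
    proof
      fix i assume "i \<in> K"
      then show "\<exists>B\<in>\<B> i (c i (f x i)). f x i \<in> B \<and> B \<subseteq> V i"
        using V(2,3) by (intro B(3)) (auto simp: K_def)
    qed
    then obtain b where b: "\<And>i. i \<in> K \<Longrightarrow> b i \<in> \<B> i (c i (f x i))" "\<And>i. i \<in> K \<Longrightarrow> f x i \<in> b i"
      "\<And>i. i \<in> K \<Longrightarrow> b i \<subseteq> V i"
      by metis
    define B' where "B' i = {x\<in>topspace X. f x i \<in> b i}" for i
    have 1: "\<forall>k\<in>K. B' k \<in> \<B>' k (c' k x) \<and> x \<in> B' k"
      using b(1,2) x by (auto simp: \<B>'_def c'_def B'_def K_def)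
    have 2: "{y\<in>topspace X. \<forall>k\<in>K. y \<in> B' k \<and> c' k y = c' k x} \<subseteq> U"
    proof
      fix y assume "y \<in> {y\<in>topspace X. \<forall>k\<in>K. y \<in> B' k \<and> c' k y = c' k x}"
      then have y: "y \<in> topspace X" "\<And>k. k \<in> K \<Longrightarrow> f y k \<in> V k"
        using b(3) by (auto simp: B'_def)
      have "f y \<in> Pi\<^sub>E I V"
      proof (rule PiE_I)
        show "f y i \<in> V i" if "i \<in> I" for i
          using y(2)[of i] fi[OF that y(1)] topY[OF that] that by (cases "i \<in> K") (auto simp: K_def)
        show "f y i = undefined" if "i \<notin> I" for i
          using continuous_map_image_subset_topspace[OF f_cont] y(1) that
          by (auto simp: image_subset_iff PiE_iff extensional_def)
      qed
      then have "f y \<in> f ` U"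
        using V(4) T(2) y(1) by blast
      then show "y \<in> U"
        using inj y(1) openin_subset[of X U] U by (auto simp: inj_on_def)
    qed
    show "\<exists>K B. finite K \<and> (\<forall>k\<in>K. B k \<in> \<B>' k (c' k x) \<and> x \<in> B k) \<and>
        {y\<in>topspace X. \<forall>k\<in>K. y \<in> B k \<and> c' k y = c' k x} \<subseteq> U"
      using V(1) 1 2 unfolding K_def[symmetric] by (intro exI[of _ K] exI[of _ B'] conjI)
  qed
  then obtain c'' :: "nat \<Rightarrow> 'a \<Rightarrow> 'b set list" and \<B>'' where "labelled_base X c'' \<B>''"
    by (rule labelled_subbase_imp_base)
  then show ?thesis
    by (rule labelled_base_imp_has_coordinates[OF reg])
qed

section \<open>Star-countable covers\<close>

text \<open>The members of a star-countable cover that are linked to a given one by chains of intersecting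
  members are countable in number. Labelling each point with the set of members linked to it
  splits the space into clopen pieces, each covered by its own countably many members.\<close>

lemma star_countable_covers_imp_has_coordinates:
  fixes X :: "'a topology"
  assumes reg: "completely_regular_space X"
    and cover: "\<And>n::nat. \<Union>(\<V> n) = topspace X"
    and op: "\<And>n V. V \<in> \<V> n \<Longrightarrow> openin X V"
    and star: "\<And>n. star_countable (\<V> n)"
    and base: "\<And>U x. \<lbrakk>openin X U; x \<in> U\<rbrakk> \<Longrightarrow> \<exists>n. \<exists>V\<in>\<V> n. x \<in> V \<and> V \<subseteq> U"
  shows "has_coordinates X"
proof -
  define R where "R n = {(V, W). V \<in> \<V> n \<and> W \<in> \<V> n \<and> W \<inter> V \<noteq> {}}" for n
  define c where "c n x = (R n)\<^sup>* `` {V\<in>\<V> n. x \<in> V}" for n x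
  have R_sym: "sym (R n)" for n
    by (auto simp: R_def sym_def)
  have R_countable: "countable (((R n) ^^ k) `` {V})" if "V \<in> \<V> n" for n k V
  proof (induction k)
    case (Suc k)
    have "countable (R n `` {W})" for W
    proof (cases "W \<in> \<V> n")
      case True
      have "R n `` {W} = {U\<in>\<V> n. U \<inter> W \<noteq> {}}"
        using True by (auto simp: R_def)
      then show ?thesis
        using star[of n] True by (simp add: star_countable_def)
    next
      case False
      then have "R n `` {W} = {}"
        by (auto simp: R_def)
      then show ?thesis
        by simp
    qed
    then have "countable (\<Union>W\<in>((R n) ^^ k) `` {V}. R n `` {W})"
      using Suc.IH by (intro countable_UN)
    moreover have "((R n) ^^ Suc k) `` {V} = (\<Union>W\<in>((R n) ^^ k) `` {V}. R n `` {W})"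
      by auto
    ultimately show ?case
      by simp
  qed simp
  have c_eq: "c n x = (R n)\<^sup>* `` {V}" if V: "V \<in> \<V> n" "x \<in> V" for n x V
  proof
    show "(R n)\<^sup>* `` {V} \<subseteq> c n x"
      using V by (auto simp: c_def)
    show "c n x \<subseteq> (R n)\<^sup>* `` {V}"
    proof
      fix W assume "W \<in> c n x"
      then obtain V' where V': "V' \<in> \<V> n" "x \<in> V'" "(V', W) \<in> (R n)\<^sup>*"
        by (auto simp: c_def)
      then have "(V, V') \<in> R n"
        using V by (auto simp: R_def)
      then show "W \<in> (R n)\<^sup>* `` {V}"
        using V'(3) by (auto intro: converse_rtrancl_into_rtrancl)
    qed
  qed
  have c_sub: "c n x \<subseteq> \<V> n" for n x
  proof
    fix W assume "W \<in> c n x"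
    then obtain V where "V \<in> \<V> n" "(V, W) \<in> (R n)\<^sup>*"
      by (auto simp: c_def)
    then show "W \<in> \<V> n"
      by (auto elim: rtranclE simp: R_def)
  qed
  have mem: "\<exists>V\<in>\<V> n. x \<in> V" if "x \<in> topspace X" for n x
    using cover[of n] that by blast
  have "labelled_base X c (\<lambda>_ l. l)"
  proof (rule labelled_baseI)
    show "openin X {y\<in>topspace X. c n y = c n x}" if x: "x \<in> topspace X" for n x
    proof -
      have "{y\<in>topspace X. c n y = c n x} = \<Union>(c n x)"
      proof
        show "{y\<in>topspace X. c n y = c n x} \<subseteq> \<Union>(c n x)"
        proof
          fix y assume "y \<in> {y\<in>topspace X. c n y = c n x}"
          then have y: "y \<in> topspace X" "c n y = c n x"
            by auto
          obtain V where V: "V \<in> \<V> n" "y \<in> V"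
            using mem[OF y(1)] by blast
          then show "y \<in> \<Union>(c n x)"
            using c_eq[OF V] y(2) by blast
        qed
        show "\<Union>(c n x) \<subseteq> {y\<in>topspace X. c n y = c n x}"
        proof
          fix y assume "y \<in> \<Union>(c n x)"
          then obtain W where W: "W \<in> c n x" "y \<in> W"
            by blast
          then have "W \<in> \<V> n"
            using c_sub by blast
          obtain V where V: "V \<in> \<V> n" "x \<in> V"
            using mem[OF x] by blast
          have VW: "(V, W) \<in> (R n)\<^sup>*"
            using W(1) c_eq[OF V] by blast
          then have WV: "(W, V) \<in> (R n)\<^sup>*"
            using sym_rtrancl[OF R_sym] by (simp add: sym_def)
          have "(R n)\<^sup>* `` {W} = (R n)\<^sup>* `` {V}"
            using VW WV by (auto intro: rtrancl_trans)
          then show "y \<in> {y\<in>topspace X. c n y = c n x}"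
            using c_eq[OF V] c_eq[OF \<open>W \<in> \<V> n\<close> W(2)] openin_subset[OF op[OF \<open>W \<in> \<V> n\<close>]] W(2)
            by auto
        qed
      qed
      moreover have "openin X (\<Union>(c n x))"
        using c_sub op by (intro openin_Union) blast
      ultimately show ?thesis
        by simp
    qed
    show "countable (c n x)" if x: "x \<in> topspace X" for n x
    proof -
      obtain V where V: "V \<in> \<V> n" "x \<in> V"
        using mem[OF x] by blast
      have "c n x = (\<Union>k. ((R n) ^^ k) `` {V})"
        unfolding c_eq[OF V] rtrancl_is_UN_relpow by blast
      then show ?thesis
        using R_countable[OF V(1)] by simp
    qed
    show "openin X B" if "B \<in> c n x" for n x B
      using that c_sub op by blast
    fix U x assume U: "openin X U" "x \<in> U"
    obtain n V where V: "V \<in> \<V> n" "x \<in> V" "V \<subseteq> U"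
      using base[OF U] by blast
    then have "V \<in> c n x"
      by (auto simp: c_def)
    then show "\<exists>n. \<exists>B\<in>c n x. x \<in> B \<and> {y\<in>B. c n y = c n x} \<subseteq> U"
      using V by blast
  qed
  then show ?thesis
    by (rule labelled_base_imp_has_coordinates[OF reg])
qed

lemma strongly_metrizable_imp_has_coordinates:
  assumes "completely_regular_space X" and "strongly_metrizable X"
  shows "has_coordinates X"
proof -
  obtain \<W> :: "nat \<Rightarrow> 'a set set" where
    W: "\<forall>n. cover_of (topspace X) (\<W> n) \<and> (\<forall>W\<in>\<W> n. openin X W) \<and> star_finite (\<W> n)"
    and base: "openin X = arbitrary union_of (\<lambda>W. W \<in> (\<Union>n. \<W> n))"
    using assms(2) unfolding strongly_metrizable_def by (elim exE conjE)
  show ?thesis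
  proof (rule star_countable_covers_imp_has_coordinates[OF assms(1)])
    show "\<Union>(\<W> n) = topspace X" for n
      using W by (simp add: cover_of_def)
    show "openin X V" if "V \<in> \<W> n" for n V
      using W that by blast
    show "star_countable (\<W> n)" for n
      using W by (simp add: star_finite_def star_countable_def countable_finite)
    show "\<exists>n. \<exists>V\<in>\<W> n. x \<in> V \<and> V \<subseteq> U" if "openin X U" "x \<in> U" for U x
    proof -
      have "\<exists>V. V \<in> (\<Union>n. \<W> n) \<and> x \<in> V \<and> V \<subseteq> U"
        using base that unfolding openin_topology_base_unique by simp
      then show ?thesis
        by blast
    qed
  qed
qed

context Metric_space
begin

lemma ball_cover_in_metric_uniformity: "\<epsilon> > 0 \<Longrightarrow> ball_cover \<epsilon> \<in> metric_uniformity"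
  by (auto simp: metric_uniformity_def cover_of_def ball_cover_def refines_def)

text \<open>Covers by sets of arbitrarily small diameter contain a base.\<close>

lemma small_covers_contain_base:
  assumes cover: "\<And>n. \<Union>(\<V> n) = M"
    and small: "\<And>n. refines (\<V> n) (ball_cover (1 / Suc n))"
    and U: "openin mtopology U" "x \<in> U"
  shows "\<exists>n. \<exists>V\<in>\<V> n. x \<in> V \<and> V \<subseteq> U"
proof -
  obtain r where "r > 0" and r: "mball x r \<subseteq> U" and x: "x \<in> M"
    using U unfolding openin_mtopology by blast
  obtain n where n: "1 / real (Suc n) < r/2"
    using \<open>r > 0\<close> by (metis half_gt_zero nat_approx_posE)
  obtain V where V: "V \<in> \<V> n" "x \<in> V"
    using x cover[of n] by blast
  then obtain z where z: "z \<in> M" "V \<subseteq> mball z (1 / Suc n)"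
    using small[of n] by (auto simp: refines_def ball_cover_def)
  have "mball z (1 / Suc n) \<subseteq> mball x r"
    using z V(2) n x by (intro mball_subset) auto
  then show ?thesis
    using V z(2) r by blast
qed

end

lemma star_countable_base_imp_has_coordinates:
  assumes reg: "completely_regular_space X" and d: "metrized_by X d"
    and base: "Metric_space.star_countable_base (topspace X) d"
  shows "has_coordinates X"
proof -
  interpret Metric_space "topspace X" d
    using d by (simp add: metrized_by_def)
  have mtop: "mtopology = X"
    using d by (simp add: metrized_by_def)
  have "\<exists>\<U>\<in>metric_uniformity. star_countable \<U> \<and> refines \<U> (ball_cover (1 / Suc n))" for n :: nat
    using base ball_cover_in_metric_uniformity[of "1 / Suc n"]
    unfolding star_countable_base_def uniformity_base_def by auto
  then obtain \<U> where \<U>: "\<And>n::nat. \<U> n \<in> metric_uniformity" "\<And>n. star_countable (\<U> n)"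
    "\<And>n. refines (\<U> n) (ball_cover (1 / Suc n))"
    by metis
  define \<V> where "\<V> n = (\<lambda>V. mtopology interior_of V) ` \<U> n" for n
  have cover: "\<Union>(\<V> n) = topspace X" for n
  proof
    show "\<Union>(\<V> n) \<subseteq> topspace X"
      using interior_of_subset_topspace[of mtopology] by (auto simp: \<V>_def)
    show "topspace X \<subseteq> \<Union>(\<V> n)"
    proof
      fix x assume x: "x \<in> topspace X"
      obtain \<epsilon> where "\<epsilon> > 0" and \<epsilon>: "refines (ball_cover \<epsilon>) (\<U> n)"
        using \<U>(1)[of n] by (auto simp: metric_uniformity_def)
      obtain V where V: "V \<in> \<U> n" "mball x \<epsilon> \<subseteq> V"
        using \<epsilon> x by (auto simp: refines_def ball_cover_def)
      then have "mball x \<epsilon> \<subseteq> mtopology interior_of V"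
        by (intro interior_of_maximal) auto
      moreover have "x \<in> mball x \<epsilon>"
        using x \<open>\<epsilon> > 0\<close> by simp
      ultimately show "x \<in> \<Union>(\<V> n)"
        using V(1) unfolding \<V>_def by blast
    qed
  qed
  show ?thesis
  proof (rule star_countable_covers_imp_has_coordinates[OF reg])
    show "\<Union>(\<V> n) = topspace X" for n
      by (rule cover)
    show "openin X V" if "V \<in> \<V> n" for n V
      using that mtop by (auto simp: \<V>_def)
    show "star_countable (\<V> n)" for n
      unfolding star_countable_def
    proof
      fix W assume "W \<in> \<V> n"
      then obtain U where U: "U \<in> \<U> n" "W = mtopology interior_of U"
        by (auto simp: \<V>_def)
      have "{V\<in>\<V> n. V \<inter> W \<noteq> {}} \<subseteq> (\<lambda>V. mtopology interior_of V) ` {V\<in>\<U> n. V \<inter> U \<noteq> {}}"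
        using interior_of_subset[of mtopology] unfolding \<V>_def U(2) by blast
      moreover have "countable {V\<in>\<U> n. V \<inter> U \<noteq> {}}"
        using \<U>(2)[of n] U(1) by (simp add: star_countable_def)
      ultimately show "countable {V\<in>\<V> n. V \<inter> W \<noteq> {}}"
        by (meson countable_image countable_subset)
    qed
    have small: "refines (\<V> n) (ball_cover (1 / Suc n))" for n
      unfolding refines_def
    proof
      fix W assume "W \<in> \<V> n"
      then obtain V where V: "V \<in> \<U> n" "W = mtopology interior_of V"
        by (auto simp: \<V>_def)
      then obtain B where "B \<in> ball_cover (1 / Suc n)" "V \<subseteq> B"
        using \<U>(3)[of n] by (auto simp: refines_def)
      then show "\<exists>U\<in>ball_cover (1 / Suc n). W \<subseteq> U"
        using V(2) interior_of_subset[of mtopology V] by blast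
    qed
    show "\<exists>n. \<exists>V\<in>\<V> n. x \<in> V \<and> V \<subseteq> U" if "openin X U" "x \<in> U" for U x
      by (rule small_covers_contain_base[where \<V> = \<V>]) (use cover small that mtop in auto)
  qed
qed

lemma star_finite_base_imp_strongly_metrizable:
  assumes d: "metrized_by X d" and base: "Metric_space.star_finite_base (topspace X) d"
  shows "strongly_metrizable X"
proof -
  interpret Metric_space "topspace X" d
    using d by (simp add: metrized_by_def)
  have mtop: "mtopology = X"
    using d by (simp add: metrized_by_def)
  have "\<exists>\<U>\<in>metric_uniformity. star_finite \<U> \<and> (\<forall>U\<in>\<U>. openin X U) \<and>
      refines \<U> (ball_cover (1 / Suc n))" for n :: nat
    using base ball_cover_in_metric_uniformity[of "1 / Suc n"]
    unfolding star_finite_base_def uniformity_base_def mtop by auto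
  then obtain \<U> where \<U>: "\<And>n::nat. \<U> n \<in> metric_uniformity" "\<And>n. star_finite (\<U> n)"
    "\<And>n U. U \<in> \<U> n \<Longrightarrow> openin X U" "\<And>n. refines (\<U> n) (ball_cover (1 / Suc n))"
    by metis
  have cover: "\<Union>(\<U> n) = topspace X" for n
    using \<U>(1)[of n] by (simp add: metric_uniformity_def cover_of_def)
  have "openin X = arbitrary union_of (\<lambda>W. W \<in> (\<Union>n. \<U> n))"
    unfolding openin_topology_base_unique
  proof (intro conjI allI impI)
    show "openin X V" if "V \<in> (\<Union>n. \<U> n)" for V
      using that \<U>(3) by blast
    show "\<exists>V. V \<in> (\<Union>n. \<U> n) \<and> x \<in> V \<and> V \<subseteq> U" if "openin X U \<and> x \<in> U" for U x
    proof -
      have "\<exists>n. \<exists>V\<in>\<U> n. x \<in> V \<and> V \<subseteq> U"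
        by (rule small_covers_contain_base[where \<V> = \<U>]) (use cover \<U>(4) that mtop in auto)
      then show ?thesis
        by blast
    qed
  qed
  then show ?thesis
    unfolding strongly_metrizable_def
    using \<U>(2,3) cover by (intro exI[of _ \<U>]) (simp add: cover_of_def)
qed

lemma star_finite_base_imp_star_countable_base:
  assumes "metrized_by X d" and "Metric_space.star_finite_base (topspace X) d"
  shows "Metric_space.star_countable_base (topspace X) d"
proof -
  interpret Metric_space "topspace X" d
    using assms(1) by (simp add: metrized_by_def)
  have imp: "star_countable \<U>" if "star_finite \<U>" for \<U>
    using that by (simp add: star_finite_def star_countable_def countable_finite)
  show ?thesis
    unfolding star_countable_base_def uniformity_base_def
  proof (intro conjI ballI)
    fix \<U> assume "\<U> \<in> metric_uniformity"
    then obtain \<V> where "\<V> \<in> metric_uniformity" "star_finite \<V>" "refines \<V> \<U>"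
      using assms(2) unfolding star_finite_base_def uniformity_base_def by auto
    then show "\<exists>\<V>\<in>{\<U>\<in>metric_uniformity. star_countable \<U>}. refines \<V> \<U>"
      using imp by auto
  qed auto
qed

section \<open>Totally bounded and Bourbaki-bounded sets\<close>

lemma in_StI: "\<lbrakk>U \<in> \<U>; z \<in> U; z \<in> A; x \<in> U\<rbrakk> \<Longrightarrow> x \<in> St A \<U>"
  by (auto simp: St_def)

lemma St_mono: "\<lbrakk>A \<subseteq> B; refines \<U> \<V>\<rbrakk> \<Longrightarrow> St A \<U> \<subseteq> St B \<V>"
proof
  fix x assume *: "A \<subseteq> B" "refines \<U> \<V>" and "x \<in> St A \<U>"
  then obtain U where U: "U \<in> \<U>" "U \<inter> A \<noteq> {}" "x \<in> U"
    by (auto simp: St_def)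
  obtain V where "V \<in> \<V>" "U \<subseteq> V"
    using *(2) U(1) by (auto simp: refines_def)
  then show "x \<in> St B \<V>"
    using * U by (auto simp: St_def)
qed

lemma St_iter_mono: "\<lbrakk>A \<subseteq> B; refines \<U> \<V>\<rbrakk> \<Longrightarrow> St_iter m A \<U> \<subseteq> St_iter m B \<V>"
  by (induction m) (auto dest: St_mono)

lemma St_iter_finite_Union:
  assumes star: "star_finite \<U>" and "finite \<F>" "\<F> \<subseteq> \<U>"
  shows "\<exists>\<F>'. finite \<F>' \<and> \<F>' \<subseteq> \<U> \<and> St_iter m (\<Union>\<F>) \<U> = \<Union>\<F>'"
proof (induction m)
  case 0
  then show ?case
    using assms by auto
next
  case (Suc m)
  then obtain \<F>' where F: "finite \<F>'" "\<F>' \<subseteq> \<U>" "St_iter m (\<Union>\<F>) \<U> = \<Union>\<F>'"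
    by (elim exE conjE)
  have "St_iter (Suc m) (\<Union>\<F>) \<U> = \<Union>(\<Union>U\<in>\<F>'. {V\<in>\<U>. V \<inter> U \<noteq> {}})"
    using F(3) by (auto simp: St_def)
  moreover have "finite (\<Union>U\<in>\<F>'. {V\<in>\<U>. V \<inter> U \<noteq> {}})"
    using F(1,2) star by (intro finite_UN_I) (auto simp: star_finite_def)
  moreover have "(\<Union>U\<in>\<F>'. {V\<in>\<U>. V \<inter> U \<noteq> {}}) \<subseteq> \<U>"
    by auto
  ultimately show ?case
    by blast
qed

context Metric_space
begin

lemma refines_ball_cover: "\<delta> \<le> \<epsilon> \<Longrightarrow> refines (ball_cover \<delta>) (ball_cover \<epsilon>)"
  unfolding refines_def ball_cover_def using mball_subset_concentric by blast

lemma mball_chain_mono: "\<delta> \<le> \<epsilon> \<Longrightarrow> mball_chain m x \<delta> \<subseteq> mball_chain m x \<epsilon>"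
  unfolding mball_chain_def by (intro St_iter_mono refines_ball_cover mball_subset_concentric)

lemma openin_mball_chain: "openin mtopology (mball_chain m x \<epsilon>)"
proof -
  have "openin mtopology (St_iter k (mball x \<epsilon>) (ball_cover \<epsilon>))" for k
    by (induction k) (auto simp: St_def ball_cover_def)
  then show ?thesis
    by (simp add: mball_chain_def)
qed

lemma mball_chain_subset: "mball_chain m x \<epsilon> \<subseteq> M"
  using openin_subset[OF openin_mball_chain] by simp

lemma centre_in_mball_chain:
  assumes "x \<in> M" "\<epsilon> > 0"
  shows "x \<in> mball_chain m x \<epsilon>"
proof -
  have "x \<in> St_iter k (mball x \<epsilon>) (ball_cover \<epsilon>)" for k
  proof (induction k)
    case (Suc k)
    have "mball x \<epsilon> \<in> ball_cover \<epsilon>" "x \<in> mball x \<epsilon>"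
      using assms by (auto simp: ball_cover_def)
    then show ?case
      using Suc.IH by (simp only: St_iter.simps in_StI)
  qed (use assms in simp)
  then show ?thesis
    by (simp add: mball_chain_def)
qed

lemma mball_chain_step:
  assumes "y \<in> mball_chain (Suc k) x \<epsilon>" "y \<in> M" "z \<in> M" "d y z < \<epsilon>"
  shows "z \<in> mball_chain (Suc (Suc k)) x \<epsilon>"
proof -
  have "\<epsilon> > 0"
    using assms(4) nonneg[of y z] by linarith
  then have "y \<in> mball y \<epsilon>" "z \<in> mball y \<epsilon>"
    using assms by auto
  moreover have "mball y \<epsilon> \<in> ball_cover \<epsilon>"
    using assms by (auto simp: ball_cover_def)
  ultimately show ?thesis
    using assms(1) unfolding mball_chain_def by (simp add: in_StI[of "mball y \<epsilon>" _ y] del: in_mball)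
qed

lemma mtotally_bounded_if_finite_cover:
  assumes "S \<subseteq> M" and cover: "\<And>\<epsilon>. \<epsilon> > 0 \<Longrightarrow> \<exists>K. finite K \<and> S \<subseteq> (\<Union>x\<in>K. mball x \<epsilon>)"
  shows "mtotally_bounded S"
  unfolding mtotally_bounded_def
proof (intro allI impI)
  fix \<epsilon> :: real assume "\<epsilon> > 0"
  then obtain K where K: "finite K" "S \<subseteq> (\<Union>x\<in>K. mball x (\<epsilon>/2))"
    using cover[of "\<epsilon>/2"] by auto
  define L where "L = {x\<in>K. mball x (\<epsilon>/2) \<inter> S \<noteq> {}}"
  have "\<forall>x\<in>L. \<exists>y. y \<in> mball x (\<epsilon>/2) \<and> y \<in> S"
    by (auto simp: L_def)
  then obtain g where g: "\<And>x. x \<in> L \<Longrightarrow> g x \<in> mball x (\<epsilon>/2)" "\<And>x. x \<in> L \<Longrightarrow> g x \<in> S"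
    by metis
  have "S \<subseteq> (\<Union>y\<in>g ` L. mball y \<epsilon>)"
  proof
    fix s assume s: "s \<in> S"
    then obtain x where x: "x \<in> K" "s \<in> mball x (\<epsilon>/2)"
      using K(2) by blast
    then have "x \<in> L"
      using s by (auto simp: L_def)
    have "d (g x) s \<le> d x (g x) + d x s"
      using g(1)[OF \<open>x \<in> L\<close>] x(2) by (intro triangle'') auto
    then have "s \<in> mball (g x) \<epsilon>"
      using g(1)[OF \<open>x \<in> L\<close>] x(2) by auto
    then show "s \<in> (\<Union>y\<in>g ` L. mball y \<epsilon>)"
      using \<open>x \<in> L\<close> by blast
  qed
  moreover have "finite (g ` L)" "g ` L \<subseteq> S"
    using K(1) g(2) by (auto simp: L_def)
  ultimately show "\<exists>K. finite K \<and> K \<subseteq> S \<and> S \<subseteq> (\<Union>x\<in>K. mball x \<epsilon>)"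
    by blast
qed

lemma TB_subset_BB: "TB \<subseteq> BB"
proof
  fix B assume "B \<in> TB"
  then have B: "mtotally_bounded B"
    by (simp add: TB_def)
  have "bourbaki_bounded B"
    unfolding bourbaki_bounded_def
  proof (intro conjI allI impI)
    show "B \<subseteq> M"
      by (rule mtotally_bounded_imp_subset[OF B])
    fix \<epsilon> :: real assume "\<epsilon> > 0"
    then have "\<exists>K. finite K \<and> K \<subseteq> B \<and> B \<subseteq> (\<Union>x\<in>K. mball x \<epsilon>)"
      using B by (simp add: mtotally_bounded_def)
    then obtain K where K: "finite K" "K \<subseteq> B" "B \<subseteq> (\<Union>x\<in>K. mball x \<epsilon>)"
      by (elim exE conjE)
    have "mball_chain 1 x \<epsilon> = mball x \<epsilon>" for x
      by (simp add: mball_chain_def)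
    then show "\<exists>m\<ge>1. \<exists>F. finite F \<and> F \<subseteq> M \<and> B \<subseteq> (\<Union>x\<in>F. mball_chain m x \<epsilon>)"
      using K \<open>B \<subseteq> M\<close> by (intro exI[of _ 1] exI[of _ K] conjI) auto
  qed
  then show "B \<in> BB"
    by (simp add: BB_def)
qed

text \<open>Iterated stars of a member of a star-finite cover are finite unions of members.\<close>

lemma star_finite_base_imp_TB_eq_BB:
  assumes star_finite_base
  shows "TB = BB"
proof (rule antisym[OF TB_subset_BB], rule subsetI)
  fix B assume "B \<in> BB"
  then have B: "bourbaki_bounded B"
    by (simp add: BB_def)
  have "mtotally_bounded B"
  proof (rule mtotally_bounded_if_finite_cover)
    show "B \<subseteq> M"
      using B by (simp add: bourbaki_bounded_def)
    fix \<epsilon> :: real assume "\<epsilon> > 0"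
    then have "ball_cover \<epsilon> \<in> metric_uniformity"
      by (rule ball_cover_in_metric_uniformity)
    then obtain \<U> where U: "\<U> \<in> metric_uniformity" "star_finite \<U>" "refines \<U> (ball_cover \<epsilon>)"
      using assms unfolding star_finite_base_def uniformity_base_def by auto
    obtain \<delta> where "\<delta> > 0" and \<delta>: "refines (ball_cover \<delta>) \<U>"
      using U(1) by (auto simp: metric_uniformity_def)
    have "\<exists>m\<ge>1. \<exists>F. finite F \<and> F \<subseteq> M \<and> B \<subseteq> (\<Union>x\<in>F. mball_chain m x \<delta>)"
      using B \<open>\<delta> > 0\<close> by (simp add: bourbaki_bounded_def)
    then obtain m F where F: "finite F" "F \<subseteq> M" "B \<subseteq> (\<Union>x\<in>F. mball_chain m x \<delta>)"
      by (elim exE conjE)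
    have "\<exists>K. finite K \<and> mball_chain m x \<delta> \<subseteq> (\<Union>z\<in>K. mball z \<epsilon>)" if x: "x \<in> F" for x
    proof -
      have "mball x \<delta> \<in> ball_cover \<delta>"
        using x F(2) by (auto simp: ball_cover_def)
      then obtain V where V: "V \<in> \<U>" "mball x \<delta> \<subseteq> V"
        using \<delta> by (auto simp: refines_def)
      then obtain \<F> where \<F>: "finite \<F>" "\<F> \<subseteq> \<U>" "St_iter (m - 1) (\<Union>{V}) \<U> = \<Union>\<F>"
        using St_iter_finite_Union[OF U(2), of "{V}" "m - 1"] by auto
      have "mball_chain m x \<delta> \<subseteq> \<Union>\<F>"
        using St_iter_mono[OF V(2) \<delta>, of "m - 1"] \<F>(3) by (simp add: mball_chain_def)
      moreover have "\<forall>V\<in>\<F>. \<exists>z. V \<subseteq> mball z \<epsilon>"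
        using \<F>(2) U(3) by (force simp: refines_def ball_cover_def)
      then obtain g where "\<And>V. V \<in> \<F> \<Longrightarrow> V \<subseteq> mball (g V) \<epsilon>"
        by metis
      ultimately have "mball_chain m x \<delta> \<subseteq> (\<Union>z\<in>g ` \<F>. mball z \<epsilon>)"
        by blast
      then show ?thesis
        using \<F>(1) by (intro exI[of _ "g ` \<F>"] conjI finite_imageI)
    qed
    then obtain K where K: "\<And>x. x \<in> F \<Longrightarrow> finite (K x)"
      "\<And>x. x \<in> F \<Longrightarrow> mball_chain m x \<delta> \<subseteq> (\<Union>z\<in>K x. mball z \<epsilon>)"
      by metis
    have "B \<subseteq> (\<Union>z\<in>(\<Union>x\<in>F. K x). mball z \<epsilon>)"
    proof
      fix y assume "y \<in> B"
      then obtain x where x: "x \<in> F" "y \<in> mball_chain m x \<delta>"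
        using F(3) by blast
      then show "y \<in> (\<Union>z\<in>(\<Union>x\<in>F. K x). mball z \<epsilon>)"
        using K(2)[OF x(1)] by blast
    qed
    moreover have "finite (\<Union>x\<in>F. K x)"
      using F(1) K(1) by (rule finite_UN_I)
    ultimately show "\<exists>K. finite K \<and> B \<subseteq> (\<Union>x\<in>K. mball x \<epsilon>)"
      by (intro exI[of _ "\<Union>x\<in>F. K x"] conjI)
  qed
  then show "B \<in> TB"
    by (simp add: TB_def)
qed

text \<open>Otherwise one could choose, one after another, a point of the \<open>j\<close>-th intersection at distance at
  least \<open>\<eta>\<close> from all earlier ones. All but finitely many of these points lie in any given one of the
  chained balls, whose radii tend to \<open>0\<close>, so they would form a Bourbaki-bounded set that is not
  totally bounded.\<close>

lemma chain_intersection_finite_cover: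
  assumes "TB = BB" and p: "\<And>i. p i \<in> M" and "\<eta> > 0"
  shows "\<exists>j K. finite K \<and> (\<Inter>i\<in>{..j}. mball_chain (Suc (m i)) (p i) (1 / Suc i)) \<subseteq> (\<Union>z\<in>K. mball z \<eta>)"
proof (rule ccontr)
  define W where "W j = (\<Inter>i\<in>{..j}. mball_chain (Suc (m i)) (p i) (1 / Suc i))" for j
  assume "\<not> ?thesis"
  then have no: "\<not> W j \<subseteq> (\<Union>z\<in>K. mball z \<eta>)" if "finite K" for j K
    using that by (auto simp: W_def)
  have "\<exists>y. \<forall>j. y j \<in> W j \<and> (\<forall>i<j. y j \<notin> mball (y i) \<eta>)"
  proof (rule dependent_wellorder_choice)
    fix r :: 'a and f g :: "nat \<Rightarrow> 'a" and j
    assume "\<And>i. i < j \<Longrightarrow> f i = g i"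
    then show "(r \<in> W j \<and> (\<forall>i<j. r \<notin> mball (f i) \<eta>)) = (r \<in> W j \<and> (\<forall>i<j. r \<notin> mball (g i) \<eta>))"
      by auto
  next
    fix j and f :: "nat \<Rightarrow> 'a"
    show "\<exists>r. r \<in> W j \<and> (\<forall>i<j. r \<notin> mball (f i) \<eta>)"
      using no[of "f ` {..<j}" j] by auto
  qed
  then obtain y where y: "\<And>j. y j \<in> W j" "\<And>i j. i < j \<Longrightarrow> y j \<notin> mball (y i) \<eta>"
    by blast
  have y_M: "y j \<in> M" for j
  proof -
    have "y j \<in> mball_chain (Suc (m j)) (p j) (1 / Suc j)"
      using y(1)[of j] unfolding W_def by blast
    then show ?thesis
      using mball_chain_subset by blast
  qed
  have "bourbaki_bounded (range y)"
    unfolding bourbaki_bounded_def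
  proof (intro conjI allI impI)
    show "range y \<subseteq> M"
      using y_M by blast
    fix \<epsilon> :: real assume "\<epsilon> > 0"
    then obtain i where i: "1 / real (Suc i) < \<epsilon>"
      by (metis nat_approx_posE)
    have "range y \<subseteq> (\<Union>x\<in>insert (p i) (y ` {..<i}). mball_chain (Suc (m i)) x \<epsilon>)"
    proof
      fix z assume "z \<in> range y"
      then obtain j where j: "z = y j"
        by blast
      show "z \<in> (\<Union>x\<in>insert (p i) (y ` {..<i}). mball_chain (Suc (m i)) x \<epsilon>)"
      proof (cases "j < i")
        case True
        then show ?thesis
          using centre_in_mball_chain[OF y_M \<open>\<epsilon> > 0\<close>] j by blast
      next
        case False
        then have "y j \<in> mball_chain (Suc (m i)) (p i) (1 / Suc i)"
          using y(1)[of j] by (auto simp: W_def)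
        then show ?thesis
          using mball_chain_mono[of "1 / Suc i" \<epsilon>] i j by auto
      qed
    qed
    then show "\<exists>m\<ge>1. \<exists>F. finite F \<and> F \<subseteq> M \<and> range y \<subseteq> (\<Union>x\<in>F. mball_chain m x \<epsilon>)"
      using p y_M by (intro exI[of _ "Suc (m i)"] exI[of _ "insert (p i) (y ` {..<i})"] conjI) auto
  qed
  then have "mtotally_bounded (range y)"
    using \<open>TB = BB\<close> by (auto simp: TB_def BB_def)
  then have "\<exists>K. finite K \<and> K \<subseteq> range y \<and> range y \<subseteq> (\<Union>x\<in>K. mball x \<eta>)"
    using \<open>\<eta> > 0\<close> by (simp add: mtotally_bounded_def)
  then obtain K where K: "finite K" "K \<subseteq> range y" "range y \<subseteq> (\<Union>x\<in>K. mball x \<eta>)"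
    by (elim exE conjE)
  obtain N where N: "finite N" "K = y ` N"
    using finite_subset_image[OF K(1,2)] by blast
  obtain j where j: "N \<subseteq> {..<j}"
    using finite_nat_iff_bounded[of N] N(1) by blast
  obtain i where "i \<in> N" "y j \<in> mball (y i) \<eta>"
    using K(3) N(2) by blast
  then show False
    using y(2)[of i j] j by blast
qed

end

text \<open>Label a point with base points of its \<open>1 / (i + 1)\<close>-chain components for \<open>i \<le> j\<close>. For such a
  label there are countably many intersections of chained balls around the base points; those that are
  covered by finitely many small balls are cut into their traces on these balls.\<close>

lemma TB_eq_BB_imp_has_coordinates:
  fixes X :: "'a topology"
  assumes reg: "completely_regular_space X" and metr: "metrized_by X d"
    and TB: "Metric_space.TB (topspace X) d = Metric_space.BB (topspace X) d"
  shows "has_coordinates X"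
proof -
  interpret Metric_space "topspace X" d
    using metr by (simp add: metrized_by_def)
  have mtop: "mtopology = X"
    using metr by (simp add: metrized_by_def)
  define R where "R i = {(x, y). x \<in> topspace X \<and> y \<in> topspace X \<and> d x y < 1 / Suc i}" for i :: nat
  define b where "b i x = (SOME y. (x, y) \<in> (R i)\<^sup>*)" for i x
  have R_sym: "sym ((R i)\<^sup>*)" for i
    by (rule sym_rtrancl) (auto simp: R_def sym_def commute)
  have b: "(x, b i x) \<in> (R i)\<^sup>*" for i x
    unfolding b_def by (rule someI[of _ x]) simp
  have b_eq: "b i y = b i x" if "(x, y) \<in> (R i)\<^sup>*" for i x y
  proof -
    have "(y, x) \<in> (R i)\<^sup>*"
      using R_sym that by (meson symD)
    then have "(\<lambda>z. (y, z) \<in> (R i)\<^sup>*) = (\<lambda>z. (x, z) \<in> (R i)\<^sup>*)"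
      using that by (auto intro: rtrancl_trans)
    then show ?thesis
      by (simp add: b_def)
  qed
  have R_top: "y \<in> topspace X" if "(x, y) \<in> (R i)\<^sup>*" "x \<in> topspace X" for i x y
    using that by (induction rule: rtrancl_induct) (auto simp: R_def)
  have chain: "\<exists>k. x \<in> mball_chain (Suc k) p (1 / Suc i)"
    if "(p, x) \<in> (R i)\<^sup>*" "p \<in> topspace X" for i p x
    using that(1)
  proof (induction rule: rtrancl_induct)
    case base
    have "p \<in> mball_chain (Suc 0) p (1 / Suc i)"
      using that(2) by (intro centre_in_mball_chain) auto
    then show ?case
      by blast
  next
    case (step y z)
    then obtain k where "y \<in> mball_chain (Suc k) p (1 / Suc i)"
      by blast
    then have "z \<in> mball_chain (Suc (Suc k)) p (1 / Suc i)"
      using step.hyps(2) by (intro mball_chain_step[of y]) (auto simp: R_def)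
    then show ?case
      by blast
  qed
  have reach: "\<exists>k. x \<in> mball_chain (Suc k) (b i x) (1 / Suc i)" if x: "x \<in> topspace X" for i x
  proof (rule chain)
    show "(b i x, x) \<in> (R i)\<^sup>*"
      using b R_sym by (meson symD)
    show "b i x \<in> topspace X"
      by (rule R_top[OF b x])
  qed
  define c where "c j x = map (\<lambda>i. b i x) [0..<Suc j]" for j x
  have c_nth: "c j x ! i = b i x" if "i \<le> j" for i j x
    using that by (simp add: c_def del: upt_Suc)
  have c_eq: "c j y = c j x \<longleftrightarrow> (\<forall>i\<le>j. b i y = b i x)" for j x y
    by (auto simp: c_def simp del: upt_Suc)
  define W where "W j ls ms = (\<Inter>i\<in>{..j}. mball_chain (Suc (ms ! i)) (ls ! i) (1 / Suc i))"
    for j ls and ms :: "nat list"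
  define coverable where "coverable n S K \<longleftrightarrow> finite K \<and> S \<subseteq> (\<Union>z\<in>K. mball z (1 / Suc n))"
    for n :: nat and S K
  define net where "net n S = (if \<exists>K. coverable n S K then SOME K. coverable n S K else {})" for n S
  have net_finite: "finite (net n S)" for n S
  proof (cases "\<exists>K. coverable n S K")
    case True
    then have "coverable n S (net n S)"
      unfolding net_def using someI_ex[of "coverable n S"] by simp
    then show ?thesis
      by (simp add: coverable_def)
  qed (simp add: net_def)
  define \<B> where "\<B> j ls = (\<Union>ms. \<Union>n. (\<lambda>z. W j ls ms \<inter> mball z (1 / Suc n)) ` net n (W j ls ms))" for j ls
  have W_open: "openin X (W j ls ms)" for j ls ms
  proof -
    have "openin mtopology (\<Inter>((\<lambda>i. mball_chain (Suc (ms ! i)) (ls ! i) (1 / Suc i)) ` {..j}))"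
      by (rule openin_Inter) (auto simp: openin_mball_chain)
    then show ?thesis
      by (simp add: W_def mtop)
  qed
  have ball_open: "openin X (mball z r)" for z r
    using openin_mball[of z r] by (simp add: mtop)
  have "labelled_base X c \<B>"
  proof (rule labelled_baseI)
    show "openin X {y\<in>topspace X. c j y = c j x}" if "x \<in> topspace X" for j x
    proof -
      have "openin mtopology {y\<in>topspace X. c j y = c j x}"
        unfolding openin_mtopology
      proof (intro conjI allI impI)
        fix y assume "y \<in> {y\<in>topspace X. c j y = c j x}"
        then have y: "y \<in> topspace X" "c j y = c j x"
          by auto
        have "mball y (1 / Suc j) \<subseteq> {y\<in>topspace X. c j y = c j x}"
        proof
          fix z assume "z \<in> mball y (1 / Suc j)"
          then have z: "z \<in> topspace X" "d y z < 1 / Suc j"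
            by auto
          have "b i z = b i y" if "i \<le> j" for i
          proof -
            have "1 / real (Suc j) \<le> 1 / real (Suc i)"
              using that by (simp add: frac_le)
            then have "(y, z) \<in> R i"
              using y z by (simp add: R_def)
            then show ?thesis
              by (intro b_eq) simp
          qed
          then show "z \<in> {y\<in>topspace X. c j y = c j x}"
            using y z by (simp add: c_eq)
        qed
        then show "\<exists>r>0. mball y r \<subseteq> {y\<in>topspace X. c j y = c j x}"
          by (intro exI[of _ "1 / Suc j"]) simp
      qed auto
      then show ?thesis
        by (simp add: mtop)
    qed
    show "countable (\<B> j (c j x))" for j x
      unfolding \<B>_def using net_finite
      by (intro countable_UN countable_image) (auto simp: countable_finite)
    show "openin X B" if "B \<in> \<B> j (c j x)" for j x B
      using that W_open ball_open by (auto simp: \<B>_def intro!: openin_Int)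
    fix U x assume U: "openin X U" "x \<in> U" and x: "x \<in> topspace X"
    have U_open: "openin mtopology U"
      using U(1) by (simp add: mtop)
    obtain r where "r > 0" and r: "mball x r \<subseteq> U"
      using U(2) U_open unfolding openin_mtopology by blast
    obtain n where n: "1 / real (Suc n) < r/2"
      using \<open>r > 0\<close> by (metis half_gt_zero nat_approx_posE)
    obtain m where m: "\<And>i. x \<in> mball_chain (Suc (m i)) (b i x) (1 / Suc i)"
      using reach[OF x] by metis
    have "b i x \<in> topspace X" for i
      using R_top[OF b x] .
    then obtain j K where jK: "finite K"
      "(\<Inter>i\<in>{..j}. mball_chain (Suc (m i)) (b i x) (1 / Suc i)) \<subseteq> (\<Union>z\<in>K. mball z (1 / Suc n))"
      using chain_intersection_finite_cover[OF TB, of "\<lambda>i. b i x" "1 / Suc n" m] by auto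
    define ms where "ms = map m [0..<Suc j]"
    have ms_nth: "ms ! i = m i" if "i \<le> j" for i
      using that by (simp add: ms_def del: upt_Suc)
    have W_eq: "W j (c j x) ms = (\<Inter>i\<in>{..j}. mball_chain (Suc (m i)) (b i x) (1 / Suc i))"
      unfolding W_def by (rule INF_cong) (simp_all add: ms_nth c_nth)
    have "coverable n (W j (c j x) ms) K"
      using jK by (simp add: coverable_def W_eq)
    then have "coverable n (W j (c j x) ms) (net n (W j (c j x) ms))"
      unfolding net_def using someI[of "coverable n (W j (c j x) ms)" K] by auto
    moreover have x_W: "x \<in> W j (c j x) ms"
      using m by (simp add: W_eq)
    ultimately obtain z where z: "z \<in> net n (W j (c j x) ms)" "x \<in> mball z (1 / Suc n)"
      unfolding coverable_def by blast
    have "mball z (1 / Suc n) \<subseteq> mball x r"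
      using z(2) n by (intro mball_subset) auto
    moreover have "W j (c j x) ms \<inter> mball z (1 / Suc n) \<in> \<B> j (c j x)"
      unfolding \<B>_def using z(1) by blast
    ultimately show "\<exists>j. \<exists>B\<in>\<B> j (c j x). x \<in> B \<and> {y\<in>B. c j y = c j x} \<subseteq> U"
      using x_W z(2) r
      by (intro exI[of _ j] bexI[of _ "W j (c j x) ms \<inter> mball z (1 / Suc n)"]) auto
  qed
  then show ?thesis
    by (rule labelled_base_imp_has_coordinates[OF reg])
qed

section \<open>The equivalences\<close>

theorem theorem2p2p10:
  fixes X :: "'a topology"
  assumes "completely_regular_space X" and "Hausdorff_space X"
  shows "all_equivalent
      [\<exists>d. metrized_by X d \<and>
           Metric_space.TB (topspace X) d = Metric_space.BB (topspace X) d,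
       \<exists>d. metrized_by X d \<and> Metric_space.star_finite_base (topspace X) d,
       \<exists>D::'a set. is_cellularity X |D| \<and> embeds_in X (Baire_times_reals D),
       embeds_in_lc_metric_product TYPE('a \<times> real) X,
       strongly_metrizable X,
       \<exists>d. metrized_by X d \<and> Metric_space.star_countable_base (topspace X) d]
    \<and> (embeds_in_lc_metric_product TYPE('b) X
          \<longrightarrow> embeds_in_lc_metric_product TYPE('a \<times> real) X)"
proof -
  let ?P1 = "\<exists>d. metrized_by X d \<and> Metric_space.TB (topspace X) d = Metric_space.BB (topspace X) d"
  let ?P2 = "\<exists>d. metrized_by X d \<and> Metric_space.star_finite_base (topspace X) d"
  let ?P3 = "\<exists>D::'a set. is_cellularity X |D| \<and> embeds_in X (Baire_times_reals D)"
  let ?P4 = "embeds_in_lc_metric_product TYPE('a \<times> real) X"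
  let ?P5 = "strongly_metrizable X"
  let ?P6 = "\<exists>d. metrized_by X d \<and> Metric_space.star_countable_base (topspace X) d"
  have c2: ?P2 and c3: ?P3 if coords: "has_coordinates X"
  proof -
    obtain \<phi> :: "nat \<Rightarrow> 'a \<Rightarrow> 'a set" and \<psi> where coords: "coordinates X \<phi> \<psi>"
      using coords unfolding has_coordinates_def by (elim exE)
    show ?P2
      by (rule coordinates_imp_star_finite_base[OF assms(2) coords])
    obtain D :: "'a set" where "is_cellularity X |D|"
      using ex_is_cellularity by metis
    then show ?P3
      using coordinates_imp_embeds_in_Baire_times_reals[OF assms(2) coords] by metis
  qed
  have 21: ?P1 if P2: ?P2
  proof -
    obtain d where d: "metrized_by X d" "Metric_space.star_finite_base (topspace X) d"
      using P2 by (elim exE conjE)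
    then have "Metric_space.TB (topspace X) d = Metric_space.BB (topspace X) d"
      by (intro Metric_space.star_finite_base_imp_TB_eq_BB) (simp_all add: metrized_by_def)
    then show ?P1
      using d(1) by (intro exI[of _ d] conjI)
  qed
  have 25: ?P5 if ?P2
    using that star_finite_base_imp_strongly_metrizable by (elim exE conjE)
  have 26: ?P6 if ?P2
    using that by (elim exE conjE) (intro exI conjI star_finite_base_imp_star_countable_base)
  have 34: ?P4 if ?P3
    using that by (elim exE conjE) (rule embeds_in_Baire_times_reals_imp_lc_metric_product)
  have 1: "has_coordinates X" if ?P1
    using that by (elim exE conjE) (rule TB_eq_BB_imp_has_coordinates[OF assms(1)])
  have 4: "has_coordinates X" if ?P4
    by (rule embeds_in_lc_metric_product_imp_has_coordinates[OF assms(1) that])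
  have any4: "has_coordinates X" if "embeds_in_lc_metric_product TYPE('b) X"
    by (rule embeds_in_lc_metric_product_imp_has_coordinates[OF assms(1) that])
  have 5: "has_coordinates X" if ?P5
    by (rule strongly_metrizable_imp_has_coordinates[OF assms(1) that])
  have 6: "has_coordinates X" if ?P6
    using that by (elim exE conjE) (rule star_countable_base_imp_has_coordinates[OF assms(1)])
  have e: "?P1 \<longleftrightarrow> has_coordinates X" "?P2 \<longleftrightarrow> has_coordinates X" "?P3 \<longleftrightarrow> has_coordinates X"
    "?P4 \<longleftrightarrow> has_coordinates X" "?P5 \<longleftrightarrow> has_coordinates X" "?P6 \<longleftrightarrow> has_coordinates X"
    by (rule iffI[OF 1 21[OF c2]] iffI[OF 5[OF 25] c2] iffI[OF 4[OF 34] c3] iffI[OF 4 34[OF c3]]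
      iffI[OF 5 25[OF c2]] iffI[OF 6 26[OF c2]]; assumption)+
  show ?thesis
  proof (intro conjI impI)
    show ?P4 if "embeds_in_lc_metric_product TYPE('b) X"
      by (rule 34[OF c3[OF any4[OF that]]])
    show "all_equivalent [?P1, ?P2, ?P3, ?P4, ?P5, ?P6]"
      unfolding e all_equivalent_def by simp
  qed
qed

end
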